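(* For every integer $k\geq 6$, the odd graph $O_k=K(2k+1,k)$ has at least $2^{2^{k-6}}$ distinct Hamilton cycles.
   Context: For integers $k\geq 1$ and $n\geq 2k+1$, the Kneser graph $K(n,k)$ is the graph whose vertices are the $k$-element subsets of $[n]=\{1,\ldots,n\}$, two subsets being adjacent if and only if they are disjoint. The odd graph is $O_k:=K(2k+1,k)$. *)

theory Defs
  imports Main
begin

(* Intended for k \<ge> 1 and n \<ge> 2 * k + 1; for k \<ge> 1 disjoint k-subsets are distinct,
   so every edge is a two-element set. *)
definition kneser_verts :: "nat \<Rightarrow> nat \<Rightarrow> nat set set" where
  "kneser_verts n k = {A. A \<subseteq> {1..n} \<and> card A = k}"

definition kneser_edges :: "nat \<Rightarrow> nat \<Rightarrow> nat set set set" where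
  "kneser_edges n k =
     {{A, B} | A B. A \<in> kneser_verts n k \<and> B \<in> kneser_verts n k \<and> A \<inter> B = {}}"

abbreviation odd_graph_verts :: "nat \<Rightarrow> nat set set" where
  "odd_graph_verts k \<equiv> kneser_verts (2 * k + 1) k"

abbreviation odd_graph_edges :: "nat \<Rightarrow> nat set set set" where
  "odd_graph_edges k \<equiv> kneser_edges (2 * k + 1) k"

definition closed_tour_edges :: "'a list \<Rightarrow> 'a set set" where
  "closed_tour_edges vs = {{vs ! i, vs ! (Suc i mod length vs)} | i. i < length vs}"

(* A Hamilton cycle is a subgraph, represented by its edge set (its vertex set is all of V).
   Hence cyclic shifts and the reversal of a vertex listing give the same cycle. *)
definition hamilton_cycle :: "'a set \<Rightarrow> 'a set set \<Rightarrow> 'a set set \<Rightarrow> bool" where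
  "hamilton_cycle V E C \<longleftrightarrow>
     (\<exists>vs. distinct vs \<and> set vs = V \<and> 3 \<le> length vs \<and>
           C = closed_tour_edges vs \<and> C \<subseteq> E)"

end

theory Submission
  imports Defs
begin

text \<open>
  The odd graph has a cycle factor indexed by Dyck words: for every Dyck word
  \<open>w\<close> of length \<open>2 * k\<close> there is a path from \<open>w\<close> to its complement in the two middle
  layers of the cube that flips every bit once, these paths partition both layers, and each of them
  is closed to a cycle of length \<open>2 * k + 1\<close> by the edge between complementary words.  A 6-cycle
  (8-cycle) that alternates between factor edges on three (four) different cycles and other edges
  merges these cycles.  A hypertree of such alternating cycles with pairwise different factor edges
  therefore yields a Hamilton cycle, and the removed factor edges can be read off from it.

  Hypertrees are built by recursion along the decomposition \<open>w = 1 u 0 v\<close>.  Alternating cycles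
  for \<open>u\<close> and for \<open>v\<close> lift to \<open>w\<close>, so all words with \<open>u\<close> of a given size are
  connected by lifted hypertrees, apart from an exception in size 2, and the few remaining components
  are joined explicitly.  The hypertrees used for \<open>u\<close> empty and for \<open>v\<close> empty can be
  chosen independently, so the number of hypertrees is at least squared when \<open>k\<close> grows by one.
\<close>

section \<open>Dyck words and the cycle factor\<close>

text \<open>Two different vertices of the odd graph have at most one common neighbour, so it has no
  4-cycle, and two factor cycles cannot be merged by exchanging one edge of each. Every join
  therefore takes three or four cycles, and two components alone can never be joined; this is why
  the two trees of size 2 are exceptional. For \<open>k \<ge> 6\<close> the recursion produces
  \<open>k + 2\<close> components: one for each size of \<open>u\<close>, and one more for each of
  the cases \<open>size u = 2\<close> and \<open>size v = 2\<close>. A join of three lowers their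
  number by two, so that odd \<open>k\<close> needs only such joins and even \<open>k\<close>
  exactly one join of four. A join must also find its edges still present, although the hypertrees
  inside the components are arbitrary. Hence some edges are banned from all hypertrees, in a way
  that reproduces itself from one size to the next. The general step starts at \<open>k = 6\<close>,
  the first \<open>k\<close> with \<open>k - 3\<close> above 2. There its last join still depends on
  a tree of size 3; two values of it give the \<open>2 = 2 ^ 2 ^ 0\<close> hypertrees from which the
  squaring starts.\<close>

datatype tree = Leaf | Node tree tree

fun word :: "tree \<Rightarrow> bool list" where
  "word Leaf = []"
| "word (Node u v) = True # word u @ False # word v"

fun neg :: "bool list \<Rightarrow> bool list" where
  "neg [] = []"
| "neg (b # s) = (\<not> b) # neg s"

lemma neg_neg [simp]: "neg (neg s) = s"
  by (induction s) auto

lemma neg_append [simp]: "neg (s @ t) = neg s @ neg t"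
  by (induction s) auto

lemma neg_rev: "neg (rev s) = rev (neg s)"
  by (induction s) auto

lemma length_neg [simp]: "length (neg s) = length s"
  by (induction s) auto

lemma neg_inject [simp]: "neg s = neg t \<longleftrightarrow> s = t"
  by (metis neg_neg)

fun ht :: "bool list \<Rightarrow> int" where
  "ht [] = 0"
| "ht (b # s) = (if b then 1 else -1) + ht s"

lemma ht_append [simp]: "ht (s @ t) = ht s + ht t"
  by (induction s) auto

lemma ht_neg [simp]: "ht (neg s) = - ht s"
  by (induction s) auto

lemma ht_rev [simp]: "ht (rev s) = ht s"
  by (induction s) auto

lemma ht_word [simp]: "ht (word t) = 0"
  by (induction t) auto

lemma length_word [simp]: "length (word t) = 2 * size t"
  by (induction t) auto

text \<open>Followed by \<open>False\<close>, a Dyck word ends exactly where the height first drops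
  below zero, so the string determines it.\<close>

lemma word_prefix_code:
  "word u @ False # r = word u' @ False # r' \<Longrightarrow> u = u' \<and> r = r'"
proof (induction u arbitrary: u' r r')
  case Leaf
  then show ?case by (cases u') auto
next
  case (Node a b)
  from Node.prems obtain a' b' where u': "u' = Node a' b'" by (cases u') simp_all
  with Node.prems have eq: "word a @ False # (word b @ False # r) = word a' @ False # (word b' @ False # r')"
    by simp
  from Node.IH(1)[OF eq] have "a = a'" "word b @ False # r = word b' @ False # r'" by simp_all
  with Node.IH(2) u' show ?case by blast
qed

lemma word_append_False_neq: "word a @ False # r \<noteq> word b"
  using word_prefix_code[of a "r @ [False]" b "[]"] by (metis append.assoc append_Cons append_is_Nil_conv not_Cons_self2)

lemma word_inject [simp]: "word a = word b \<longleftrightarrow> a = b"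
  using word_prefix_code[of a "[]" b "[]"] by auto

fun snoc :: "tree \<Rightarrow> tree \<Rightarrow> tree" where
  "snoc Leaf u = Node u Leaf"
| "snoc (Node a b) u = Node a (snoc b u)"

text \<open>Reversal followed by complementation maps Dyck words to Dyck words; this is its effect
  on trees. It reduces parsing from the right end to parsing from the left.\<close>

fun mirror :: "tree \<Rightarrow> tree" where
  "mirror Leaf = Leaf"
| "mirror (Node u v) = snoc (mirror v) (mirror u)"

lemma word_snoc: "word (snoc t u) = word t @ True # word u @ [False]"
  by (induction t) auto

lemma word_mirror: "word (mirror t) = rev (neg (word t))"
  by (induction t) (auto simp: word_snoc)

lemma neg_word: "neg (word t) = rev (word (mirror t))"
  by (simp add: word_mirror)

lemma rev_word: "rev (word t) = neg (word (mirror t))"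
  by (simp add: word_mirror neg_rev)

lemma neg_word_suffix_code:
  assumes "x @ False # neg (word v) = x' @ False # neg (word v')"
  shows "v = v' \<and> x = x'"
proof -
  from assms have "word (mirror v) @ False # rev x = word (mirror v') @ False # rev x'"
    unfolding neg_word by (metis append.assoc append_Cons append_Nil rev.simps(2) rev_append rev_rev_ident)
  then have "mirror v = mirror v'" "x = x'"
    by (auto dest!: word_prefix_code)
  then show ?thesis
    by (metis neg_neg neg_word word_inject)
qed

lemma neg_word_suffix_neq: "False # x @ False # neg (word v) \<noteq> neg (word t)"
proof
  assume "False # x @ False # neg (word v) = neg (word t)"
  then have "rev (False # x @ False # neg (word v)) = rev (neg (word t))" by simp
  then have "word (mirror v) @ False # (rev x @ [False]) = word (mirror t)"
    by (simp add: neg_word)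
  then show False using word_append_False_neq by blast
qed

text \<open>The alternative is whether the height ever drops below zero. A string that never drops
  and does not end above zero is a Dyck word; otherwise it is cut at the first drop.\<close>

lemma word_parse:
  "ht s \<le> 0 \<Longrightarrow> (\<exists>t. s = word t) \<or> (\<exists>t r. s = word t @ False # r)"
proof (induction s rule: length_induct)
  case (1 s)
  show ?case
  proof (cases s)
    case Nil
    then show ?thesis by (metis word.simps(1))
  next
    case (Cons b s')
    show ?thesis
    proof (cases b)
      case False
      then show ?thesis using Cons by (metis append_Nil word.simps(1))
    next
      case True
      with Cons 1 have "ht s' \<le> -1" by simp
      then have "\<not> (\<exists>t. s' = word t)" by auto
      moreover have "length s' < length s" "ht s' \<le> 0" using Cons \<open>ht s' \<le> -1\<close> by auto
      ultimately obtain a r1 where s': "s' = word a @ False # r1"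
        using 1(1) by blast
      with \<open>ht s' \<le> -1\<close> have "ht r1 \<le> 0" by simp
      moreover have "length r1 < length s" using s' Cons by simp
      ultimately have "(\<exists>t. r1 = word t) \<or> (\<exists>t r. r1 = word t @ False # r)"
        using 1(1) by blast
      then show ?thesis
      proof (elim disjE exE)
        fix b' assume "r1 = word b'"
        then have "s = word (Node a b')" using Cons True s' by simp
        then show ?thesis by blast
      next
        fix b' r assume "r1 = word b' @ False # r"
        then have "s = word (Node a b') @ False # r" using Cons True s' by simp
        then show ?thesis by blast
      qed
    qed
  qed
qed

text \<open>
  The path of a tree leads from its Dyck word to the complement of that word and flips every bit
  exactly once.  For the word \<open>1 u 0 v\<close> it first complements \<open>v\<close> along the path of
  \<open>v\<close>, then flips the opening bracket of the root, then complements \<open>u\<close> along the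
  path of \<open>u\<close> run backwards (read through complementation, so that the two layers are exchanged),
  and finally flips the closing bracket.
\<close>

definition row :: "tree \<Rightarrow> bool list \<Rightarrow> bool list" where
  "row u s = True # word u @ False # s"

definition col :: "tree \<Rightarrow> bool list \<Rightarrow> bool list" where
  "col v s = False # neg s @ False # neg (word v)"

fun path :: "tree \<Rightarrow> bool list list" where
  "path Leaf = [[]]"
| "path (Node u v) = map (row u) (path v) @ rev (map (col v) (path u)) @ [neg (word (Node u v))]"

lemma row_inject [simp]: "row u s = row u t \<longleftrightarrow> s = t"
  by (simp add: row_def)

lemma col_inject [simp]: "col u s = col u t \<longleftrightarrow> s = t"
  by (simp add: col_def)

lemma row_neq_col [simp]: "row u s \<noteq> col v t" "col v t \<noteq> row u s"
  by (simp_all add: row_def col_def)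

lemma row_neq_neg_word [simp]: "row u s \<noteq> neg (word t)" "neg (word t) \<noteq> row u s"
  by (cases t; simp add: row_def)+

lemma col_neq_neg_word [simp]: "col v s \<noteq> neg (word t)" "neg (word t) \<noteq> col v s"
  using neg_word_suffix_neq unfolding col_def by metis+

lemma row_eq_row: "row u s = row u' s' \<longleftrightarrow> u = u' \<and> s = s'"
  by (auto simp: row_def dest: word_prefix_code)

lemma col_eq_col: "col v s = col v' s' \<longleftrightarrow> v = v' \<and> s = s'"
  by (auto simp: col_def dest!: neg_word_suffix_code)

lemma path_not_Nil [simp]: "path t \<noteq> []"
  by (cases t) auto

lemma hd_path [simp]: "hd (path t) = word t"
  by (induction t) (auto simp: hd_map row_def)

lemma last_path [simp]: "last (path t) = neg (word t)"
  by (cases t) auto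

lemma length_path: "length (path t) = 2 * size t + 1"
  by (induction t) auto

lemma distinct_path: "distinct (path t)"
proof (induction t)
  case (Node u v)
  then show ?case
    by (auto simp: distinct_map inj_on_def simp del: word.simps)
qed simp

lemma set_path_Node:
  "set (path (Node u v)) = row u ` set (path v) \<union> col v ` set (path u) \<union> {neg (word (Node u v))}"
  by auto

lemma word_in_path [simp]: "word t \<in> set (path t)"
  by (metis hd_in_set hd_path path_not_Nil)

lemma neg_word_in_path [simp]: "neg (word t) \<in> set (path t)"
  by (metis last_in_set last_path path_not_Nil)

text \<open>Row vertices, column vertices and complements of Dyck words never coincide. A row
  reveals \<open>u\<close> and a column reveals \<open>v\<close> by unique decoding; induction
  yields the other subtree.\<close>

lemma path_inject: "s \<in> set (path t) \<Longrightarrow> s \<in> set (path t') \<Longrightarrow> t = t'"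
proof (induction t arbitrary: s t')
  case Leaf
  then show ?case by (cases t') (auto simp: row_def col_def)
next
  case (Node u v)
  show ?case
  proof (cases t')
    case Leaf
    with Node show ?thesis by (auto simp: row_def col_def)
  next
    case (Node u' v')
    have "s \<in> row u' ` set (path v') \<union> col v' ` set (path u') \<union> {neg (word (Node u' v'))}"
      "s \<in> row u ` set (path v) \<union> col v ` set (path u) \<union> {neg (word (Node u v))}"
      using Node.prems unfolding Node set_path_Node by blast+
    then show ?thesis unfolding Node
      using Node.IH by (auto simp: row_eq_row col_eq_col simp del: word.simps neg.simps)
  qed
qed

text \<open>
  A vertex of the odd graph is encoded by a word of length \<open>2 * k\<close>, the element \<open>2 * k + 1\<close>
  being left implicit: a set containing it is the set of ones of a word of height \<open>-2\<close>, a set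
  avoiding it is the set of zeros of a word of height \<open>0\<close>.
\<close>

definition states :: "nat \<Rightarrow> bool list set" where
  "states k = {s. length s = 2 * k \<and> (ht s = 0 \<or> ht s = -2)}"

lemma path_subset_states: "s \<in> set (path t) \<Longrightarrow> s \<in> states (size t)"
  by (induction t arbitrary: s) (auto simp: states_def row_def col_def, metis+)

text \<open>The first bit decides. A leading \<open>True\<close> must be closed, which exhibits a
  row; a word with leading \<open>False\<close> is parsed from the right and is a complement of a
  Dyck word or a column.\<close>

lemma states_covered: "s \<in> states k \<Longrightarrow> \<exists>t. size t = k \<and> s \<in> set (path t)"
proof (induction k arbitrary: s rule: less_induct)
  case (less k)
  show ?case
  proof (cases s)
    case Nil
    with less.prems show ?thesis by (intro exI[of _ Leaf]) (auto simp: states_def)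
  next
    case (Cons b s')
    show ?thesis
    proof (cases b)
      case True
      with Cons less.prems have "ht s' \<le> -1" by (auto simp: states_def)
      then have "\<not> (\<exists>t. s' = word t)" by auto
      then obtain u r where s': "s' = word u @ False # r"
        using word_parse[of s'] \<open>ht s' \<le> -1\<close> by auto
      with Cons True less.prems have "r \<in> states (k - 1 - size u)" "size u < k"
        by (auto simp: states_def)
      then obtain v where "size v = k - 1 - size u" "r \<in> set (path v)"
        using less.IH[of "k - 1 - size u"] by auto
      then show ?thesis using Cons True s' \<open>size u < k\<close>
        by (intro exI[of _ "Node u v"]) (auto simp: row_def)
    next
      case False
      from less.prems have "ht (rev s) \<le> 0" by (auto simp: states_def)
      then consider t where "rev s = word t" | t r where "rev s = word t @ False # r"
        using word_parse by blast
      then show ?thesis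
      proof cases
        case 1
        then have s: "s = neg (word (mirror t))" by (metis rev_rev_ident rev_word)
        then have "2 * size (mirror t) = 2 * k" using less.prems by (simp add: states_def)
        then show ?thesis using s by (intro exI[of _ "mirror t"]) simp
      next
        case 2
        define v where "v = mirror t"
        from 2 have "rev (rev s) = rev (word t @ False # r)" by simp
        then have s: "s = rev r @ False # neg (word v)" by (simp add: v_def rev_word)
        have "ht s = ht r - 1" using s by simp
        \<comment> \<open>Parity: an empty \<open>r\<close> would give height -1, which no state
          has.\<close>
        with less.prems have "r \<noteq> []" by (auto simp: states_def)
        then obtain y where y: "rev r = False # y"
          using s Cons False by (cases "rev r") auto
        define x where "x = neg y"
        have sc: "s = col v x" using s y by (simp add: x_def col_def)
        then have "x \<in> states (k - 1 - size v)" "size v < k"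
          using less.prems by (auto simp: states_def col_def)
        then obtain u where "size u = k - 1 - size v" "x \<in> set (path u)"
          using less.IH[of "k - 1 - size v"] by auto
        then show ?thesis using sc \<open>size v < k\<close>
          by (intro exI[of _ "Node u v"]) auto
      qed
    qed
  qed
qed

section \<open>Opening and closing Hamilton cycles\<close>

fun walk_edges :: "'a list \<Rightarrow> 'a set set" where
  "walk_edges (x # y # xs) = insert {x, y} (walk_edges (y # xs))"
| "walk_edges _ = {}"

lemma walk_edges_append:
  "xs \<noteq> [] \<Longrightarrow> ys \<noteq> [] \<Longrightarrow>
    walk_edges (xs @ ys) = insert {last xs, hd ys} (walk_edges xs \<union> walk_edges ys)"
proof (induction xs rule: walk_edges.induct)
  case ("2_2" v)
  then show ?case by (cases ys) auto
qed auto

lemma walk_edges_rev [simp]: "walk_edges (rev xs) = walk_edges xs"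
proof (induction xs rule: walk_edges.induct)
  case (1 x y xs)
  then show ?case
    using walk_edges_append[of "rev (y # xs)" "[x]"] by (simp add: insert_commute)
qed auto

lemma walk_edges_map: "walk_edges (map f xs) = image f ` walk_edges xs"
  by (induction xs rule: walk_edges.induct) auto

lemma walk_edges_subset: "e \<in> walk_edges xs \<Longrightarrow> e \<subseteq> set xs"
  by (induction xs rule: walk_edges.induct) auto

lemma walk_edges_conv_nth: "walk_edges xs = {{xs ! i, xs ! Suc i} | i. Suc i < length xs}"
proof (induction xs rule: walk_edges.induct)
  case (1 x y xs)
  have "{{(x # y # xs) ! i, (x # y # xs) ! Suc i} | i. Suc i < length (x # y # xs)}
     = insert {x, y} {{(y # xs) ! i, (y # xs) ! Suc i} | i. Suc i < length (y # xs)}" (is "?A = ?B")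
  proof
    show "?A \<subseteq> ?B"
    proof
      fix e assume "e \<in> ?A"
      then obtain i where i: "Suc i < length (x # y # xs)" "e = {(x # y # xs) ! i, (x # y # xs) ! Suc i}"
        by blast
      then show "e \<in> ?B" by (cases i) auto
    qed
    show "?B \<subseteq> ?A"
    proof
      fix e assume "e \<in> ?B"
      then consider "e = {x, y}" | i where "Suc i < length (y # xs)" "e = {(y # xs) ! i, (y # xs) ! Suc i}"
        by blast
      then show "e \<in> ?A"
      proof cases
        case 1
        then show ?thesis by (intro CollectI exI[of _ 0]) auto
      next
        case (2 i)
        then show ?thesis by (intro CollectI exI[of _ "Suc i"]) auto
      qed
    qed
  qed
  with 1 show ?case by simp
qed auto

lemma closed_tour_edges_conv:
  assumes "vs \<noteq> []"
  shows "closed_tour_edges vs = insert {last vs, hd vs} (walk_edges vs)"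
proof -
  let ?n = "length vs"
  let ?e = "\<lambda>i. {vs ! i, vs ! (Suc i mod ?n)}"
  have "0 < ?n" using assms by simp
  have "closed_tour_edges vs = ?e ` {..<?n}"
    unfolding closed_tour_edges_def by blast
  also have "{..<?n} = insert (?n - 1) {i. Suc i < ?n}"
    using \<open>0 < ?n\<close> by (auto simp: less_eq_Suc_le)
  also have "?e ` \<dots> = insert (?e (?n - 1)) (?e ` {i. Suc i < ?n})"
    by (rule image_insert)
  also have "?e (?n - 1) = {last vs, hd vs}"
    using assms \<open>0 < ?n\<close> by (simp add: last_conv_nth hd_conv_nth)
  also have "?e ` {i. Suc i < ?n} = (\<lambda>i. {vs ! i, vs ! Suc i}) ` {i. Suc i < ?n}"
    by (rule image_cong) simp_all
  also have "\<dots> = walk_edges vs"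
    unfolding walk_edges_conv_nth by blast
  finally show ?thesis .
qed

lemma closed_tour_edges_rotate1:
  assumes "vs \<noteq> []"
  shows "closed_tour_edges (rotate1 vs) = closed_tour_edges vs"
proof -
  obtain x xs where vs: "vs = x # xs" using assms by (cases vs) auto
  show ?thesis
  proof (cases xs)
    case (Cons y ys)
    then show ?thesis
      using walk_edges_append[of xs "[x]"]
      by (simp add: vs closed_tour_edges_conv insert_commute)
  qed (simp add: vs)
qed

lemma closed_tour_edges_rotate:
  "vs \<noteq> [] \<Longrightarrow> closed_tour_edges (rotate n vs) = closed_tour_edges vs"
  by (induction n) (auto simp: closed_tour_edges_rotate1 simp flip: rotate1_rotate_swap)

definition ham_path :: "'a set \<Rightarrow> 'a set set \<Rightarrow> 'a \<Rightarrow> 'a \<Rightarrow> bool" where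
  "ham_path V P a b \<longleftrightarrow>
     (\<exists>vs. vs \<noteq> [] \<and> distinct vs \<and> set vs = V \<and> hd vs = a \<and> last vs = b \<and> P = walk_edges vs)"

lemma ham_path_join:
  assumes "ham_path V1 P1 a1 b1" "ham_path V2 P2 a2 b2" "V1 \<inter> V2 = {}"
  shows "ham_path (V1 \<union> V2) (insert {b1, a2} (P1 \<union> P2)) a1 b2"
proof -
  obtain xs ys where
    "xs \<noteq> []" "distinct xs" "set xs = V1" "hd xs = a1" "last xs = b1" "P1 = walk_edges xs"
    "ys \<noteq> []" "distinct ys" "set ys = V2" "hd ys = a2" "last ys = b2" "P2 = walk_edges ys"
    using assms(1,2) unfolding ham_path_def by blast
  then show ?thesis using assms(3) unfolding ham_path_def
    by (intro exI[of _ "xs @ ys"]) (auto simp: walk_edges_append)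
qed

lemma ham_path_close:
  assumes "ham_path V P a b" "3 \<le> card V" "insert {b, a} P \<subseteq> E"
  shows "hamilton_cycle V E (insert {b, a} P)"
proof -
  obtain xs where xs: "xs \<noteq> []" "distinct xs" "set xs = V" "hd xs = a" "last xs = b" "P = walk_edges xs"
    using assms(1) unfolding ham_path_def by blast
  then have "3 \<le> length xs" using assms(2) distinct_card by fastforce
  then show ?thesis using xs assms(3) unfolding hamilton_cycle_def
    by (intro exI[of _ xs]) (auto simp: closed_tour_edges_conv)
qed

text \<open>With only two vertices the closing edge would be the walk edge itself, hence the bound
  3.\<close>

lemma closing_edge_not_in_walk:
  assumes "distinct vs" "3 \<le> length vs"
  shows "{last vs, hd vs} \<notin> walk_edges vs"
proof
  assume "{last vs, hd vs} \<in> walk_edges vs"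
  then obtain i where i: "Suc i < length vs" "{last vs, hd vs} = {vs ! i, vs ! Suc i}"
    by (auto simp: walk_edges_conv_nth)
  have "vs \<noteq> []" using assms(2) by auto
  then have "last vs = vs ! (length vs - 1)" "hd vs = vs ! 0"
    by (auto simp: last_conv_nth hd_conv_nth)
  with i have eq: "{vs ! (length vs - 1), vs ! 0} = {vs ! i, vs ! Suc i}" by simp
  have inj: "vs ! m = vs ! n \<longleftrightarrow> m = n" if "m < length vs" "n < length vs" for m n
    using assms(1) that by (rule nth_eq_iff_index_eq)
  have "length vs - 1 < length vs" "0 < length vs" "i < length vs" using i(1) by linarith+
  with eq i(1) inj have "length vs - 1 = i \<and> 0 = Suc i \<or> length vs - 1 = Suc i \<and> 0 = i"
    unfolding doubleton_eq_iff by blast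
  then show False using i(1) assms(2) by linarith
qed

text \<open>The listing is rotated until the given edge is its closing edge, and reversed if it then
  runs from \<open>b\<close> to \<open>a\<close>.\<close>

lemma hamilton_cycle_open:
  assumes "hamilton_cycle V E C" "{a, b} \<in> C"
  shows "ham_path V (C - {{a, b}}) a b"
proof -
  obtain vs where vs: "distinct vs" "set vs = V" "3 \<le> length vs" "C = closed_tour_edges vs"
    using assms(1) unfolding hamilton_cycle_def by blast
  obtain i where i: "i < length vs" "{a, b} = {vs ! i, vs ! (Suc i mod length vs)}"
    using assms(2) vs(4) unfolding closed_tour_edges_def by blast
  define ws where "ws = rotate (Suc i) vs"
  have ne: "vs \<noteq> []" "ws \<noteq> []" using vs(3) by (auto simp: ws_def)
  have "C = closed_tour_edges ws"
    unfolding ws_def vs(4) by (rule closed_tour_edges_rotate[OF ne(1), symmetric])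
  then have ws: "distinct ws" "set ws = V" "3 \<le> length ws" "C = insert {last ws, hd ws} (walk_edges ws)"
    using vs(1-3) closed_tour_edges_conv[OF ne(2)] by (simp_all add: ws_def del: rotate_Suc)
  have hd: "hd ws = vs ! (Suc i mod length vs)"
    unfolding ws_def using ne by (simp add: hd_rotate_conv_nth del: rotate_Suc)
  have "last ws = ws ! (length vs - 1)" using ne by (simp add: last_conv_nth ws_def)
  also have "\<dots> = vs ! ((Suc i + (length vs - 1)) mod length vs)"
    unfolding ws_def using ne by (intro nth_rotate) simp
  also have "Suc i + (length vs - 1) = i + length vs" using i(1) by simp
  also have "\<dots> mod length vs = i" using i(1) by simp
  finally have last: "last ws = vs ! i" .
  have ab: "{a, b} = {last ws, hd ws}" using i hd last by simp
  then have "walk_edges ws = C - {{a, b}}"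
    using ws(4) closing_edge_not_in_walk[OF ws(1,3)] by auto
  moreover from ab have "(a = hd ws \<and> b = last ws) \<or> (a = last ws \<and> b = hd ws)"
    by (auto simp: doubleton_eq_iff)
  ultimately show ?thesis unfolding ham_path_def
  proof (elim disjE)
    assume *: "walk_edges ws = C - {{a, b}}" "a = last ws \<and> b = hd ws"
    show "\<exists>vs. vs \<noteq> [] \<and> distinct vs \<and> set vs = V \<and> hd vs = a \<and> last vs = b \<and> C - {{a, b}} = walk_edges vs"
      using * ws ne by (intro exI[of _ "rev ws"]) (auto simp: hd_rev last_rev)
  qed (use ws ne in blast)
qed

section \<open>Joining cycles of the factor\<close>

inductive adj :: "bool list \<Rightarrow> bool list \<Rightarrow> bool" where
  adj_flip: "adj (b # s) ((\<not> b) # s)"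
| adj_Cons: "adj s t \<Longrightarrow> adj (b # s) (b # t)"

lemma adj_sym: "adj s t \<Longrightarrow> adj t s"
  by (induction rule: adj.induct) (auto intro: adj.intros adj_flip[of "\<not> b" for b, simplified])

lemma adj_Cons_iff: "adj (b # s) (c # t) \<longleftrightarrow> (b = c \<and> adj s t) \<or> (b \<noteq> c \<and> s = t)"
  by (auto elim: adj.cases intro: adj.intros adj_flip[of "\<not> c" for c, simplified])

lemma adj_append_left [simp]: "adj (r @ s) (r @ t) \<longleftrightarrow> adj s t"
  by (induction r) (auto simp: adj_Cons_iff)

lemma adj_append_right: "adj s t \<Longrightarrow> adj (s @ r) (t @ r)"
  by (induction rule: adj.induct) (auto intro: adj.intros)

lemma adj_neg: "adj s t \<Longrightarrow> adj (neg s) (neg t)"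
  by (induction rule: adj.induct) (auto simp: adj_Cons_iff)

lemma adj_row: "adj s t \<Longrightarrow> adj (row u s) (row u t)"
  by (simp add: row_def adj_Cons_iff)

lemma adj_col: "adj s t \<Longrightarrow> adj (col v s) (col v t)"
  by (simp add: col_def adj_Cons_iff adj_neg adj_append_right)

lemma adj_row_col: "adj (row u (neg (word v))) (col v (neg (word u)))"
  by (simp add: row_def col_def adj_Cons_iff)

lemma adj_col_end: "adj (col v (word u)) (neg (word (Node u v)))"
  by (simp add: col_def adj_Cons_iff)

text \<open>
  Two sets that both avoid \<open>2 * k + 1\<close> are disjoint iff their words are complementary; this
  is the edge closing the path of a tree to a cycle.
\<close>

definition state_edges :: "bool list set set" where
  "state_edges = {{s, t} | s t. adj s t} \<union> {{s, neg s} | s. True}"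

lemma walk_edges_path_Node:
  "walk_edges (path (Node u v)) =
     image (row u) ` walk_edges (path v) \<union> image (col v) ` walk_edges (path u) \<union>
     {{row u (neg (word v)), col v (neg (word u))}, {col v (word u), neg (word (Node u v))}}"
  by (simp add: walk_edges_append walk_edges_map last_map hd_map hd_rev last_rev
      rev_map[symmetric] del: word.simps)

text \<open>
  Every edge of the path of a tree flips one bracket of its word.  The address names the node that
  carries this bracket (\<open>Le\<close> and \<open>Ri\<close> descend into the subtrees) and whether it is the
  opening or the closing one.
\<close>

datatype addr = Op | Cl | Le addr | Ri addr

fun valid :: "tree \<Rightarrow> addr \<Rightarrow> bool" where
  "valid Leaf a = False"
| "valid (Node u v) Op = True"
| "valid (Node u v) Cl = True"
| "valid (Node u v) (Le a) = valid u a"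
| "valid (Node u v) (Ri a) = valid v a"

fun ends :: "tree \<Rightarrow> addr \<Rightarrow> bool list \<times> bool list" where
  "ends Leaf a = ([], [])"
| "ends (Node u v) Op = (row u (neg (word v)), col v (neg (word u)))"
| "ends (Node u v) Cl = (col v (word u), neg (word (Node u v)))"
| "ends (Node u v) (Le a) = map_prod (col v) (col v) (ends u a)"
| "ends (Node u v) (Ri a) = map_prod (row u) (row u) (ends v a)"

definition edge :: "tree \<Rightarrow> addr \<Rightarrow> bool list set" where
  "edge t a = {fst (ends t a), snd (ends t a)}"

lemma edge_Node [simp]:
  "edge (Node u v) Op = {row u (neg (word v)), col v (neg (word u))}"
  "edge (Node u v) Cl = {col v (word u), neg (word (Node u v))}"
  "edge (Node u v) (Le a) = col v ` edge u a"
  "edge (Node u v) (Ri a) = row u ` edge v a"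
  by (auto simp: edge_def)

lemma edge_in_walk: "valid t a \<Longrightarrow> edge t a \<in> walk_edges (path t)"
  by (induction t a rule: valid.induct) (auto simp: walk_edges_path_Node simp del: path.simps word.simps)

lemma walk_is_edge: "e \<in> walk_edges (path t) \<Longrightarrow> \<exists>a. valid t a \<and> e = edge t a"
proof (induction t arbitrary: e)
  case (Node u v)
  then consider e' where "e' \<in> walk_edges (path v)" "e = row u ` e'"
    | e' where "e' \<in> walk_edges (path u)" "e = col v ` e'"
    | "e = edge (Node u v) Op" | "e = edge (Node u v) Cl"
    by (auto simp: walk_edges_path_Node simp del: path.simps word.simps)
  then show ?case
  proof cases
    case 1
    with Node.IH(2) obtain a where "valid v a" "e' = edge v a" by blast
    with 1 show ?thesis by (intro exI[of _ "Ri a"]) simp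
  next
    case 2
    with Node.IH(1) obtain a where "valid u a" "e' = edge u a" by blast
    with 2 show ?thesis by (intro exI[of _ "Le a"]) simp
  qed (use valid.simps in blast)+
qed simp

lemma edge_adj: "valid t a \<Longrightarrow> adj (fst (ends t a)) (snd (ends t a))"
  by (induction t a rule: valid.induct)
    (auto simp: adj_row adj_col adj_row_col adj_col_end simp del: word.simps)

lemma edge_subset_path: "valid t a \<Longrightarrow> edge t a \<subseteq> set (path t)"
  by (meson edge_in_walk walk_edges_subset)

lemma edge_not_empty [simp]: "edge t a \<noteq> {}"
  by (simp add: edge_def)

lemma row_image_eq: "row u ` A = row u ` B \<longleftrightarrow> A = B"
  by (intro inj_image_eq_iff injI) simp

lemma col_image_eq: "col u ` A = col u ` B \<longleftrightarrow> A = B"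
  by (intro inj_image_eq_iff injI) simp

lemma row_col_image_disjoint:
  "A \<noteq> {} \<Longrightarrow> row u ` A \<noteq> col v ` B" "A \<noteq> {} \<Longrightarrow> col v ` A \<noteq> row u ` B"
proof -
  have "row u ` A' \<inter> col v ` B' = {}" for A' B' by auto
  then show "A \<noteq> {} \<Longrightarrow> row u ` A \<noteq> col v ` B" "A \<noteq> {} \<Longrightarrow> col v ` A \<noteq> row u ` B"
    by (metis Int_absorb image_is_empty)+
qed

lemma edge_Op_not_image:
  "{row u s, col v t} \<noteq> row u' ` A" "{row u s, col v t} \<noteq> col v' ` A"
  "row u' ` A \<noteq> {row u s, col v t}" "col v' ` A \<noteq> {row u s, col v t}"
  by (metis image_iff insertCI row_neq_col)+

lemma edge_Cl_not_image:
  "{s, neg (word t)} \<noteq> row u ` A" "{s, neg (word t)} \<noteq> col v ` A"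
  "row u ` A \<noteq> {s, neg (word t)}" "col v ` A \<noteq> {s, neg (word t)}"
  by (metis image_iff insertCI row_neq_neg_word col_neq_neg_word)+

text \<open>The ends show the kind of edge: two rows for \<open>Ri\<close>, two columns for
  \<open>Le\<close>, a row and a column for \<open>Op\<close>, a complement of a Dyck word for
  \<open>Cl\<close>.\<close>

lemma edge_inject: "valid t a \<Longrightarrow> valid t b \<Longrightarrow> edge t a = edge t b \<Longrightarrow> a = b"
proof (induction t arbitrary: a b)
  case (Node u v)
  have Op_Cl: "edge (Node u v) Op \<noteq> edge (Node u v) Cl"
    by (simp add: doubleton_eq_iff del: word.simps)
  note not_image = row_image_eq col_image_eq row_col_image_disjoint edge_Op_not_image edge_Cl_not_image
  show ?case
  proof (cases a)
    case Op
    with Node.prems(2,3) Op_Cl show ?thesis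
      by (cases b) (simp_all add: not_image del: word.simps)
  next
    case Cl
    with Node.prems(2,3) Op_Cl[symmetric] show ?thesis
      by (cases b) (simp_all add: not_image del: word.simps)
  next
    case (Le a')
    with Node.prems obtain b' where "b = Le b'"
      by (cases b) (simp_all add: not_image del: word.simps)
    with Le Node.prems Node.IH(1)[of a' b'] show ?thesis
      by (simp add: not_image)
  next
    case (Ri a')
    with Node.prems obtain b' where "b = Ri b'"
      by (cases b) (simp_all add: not_image del: word.simps)
    with Ri Node.prems Node.IH(2)[of a' b'] show ?thesis
      by (simp add: not_image)
  qed
qed simp

lemma edge_inject_tree:
  assumes "valid t a" "valid t' b" "edge t a = edge t' b"
  shows "t = t' \<and> a = b"
proof -
  have "t = t'"
    using assms edge_subset_path path_inject by (metis edge_not_empty ex_in_conv subsetD)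
  with assms edge_inject show ?thesis by blast
qed

definition orient :: "tree \<times> addr \<Rightarrow> bool list \<Rightarrow> bool list \<Rightarrow> bool" where
  "orient x a b \<longleftrightarrow> valid (fst x) (snd x) \<and>
     (ends (fst x) (snd x) = (a, b) \<or> ends (fst x) (snd x) = (b, a))"

text \<open>An alternating 6-cycle \<open>a b c d e f\<close>: \<open>ab\<close>, \<open>cd\<close>,
  \<open>ef\<close> are factor edges, each usable in both directions, and \<open>bc\<close>,
  \<open>de\<close>, \<open>fa\<close> are cube edges to be added.\<close>

definition alt3 :: "tree \<times> addr \<Rightarrow> tree \<times> addr \<Rightarrow> tree \<times> addr \<Rightarrow> bool" where
  "alt3 x y z \<longleftrightarrow> (\<exists>a b c d e f. orient x a b \<and> orient y c d \<and> orient z e f \<and>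
     adj b c \<and> adj d e \<and> adj f a)"

definition alt4 :: "tree \<times> addr \<Rightarrow> tree \<times> addr \<Rightarrow> tree \<times> addr \<Rightarrow> tree \<times> addr \<Rightarrow> bool" where
  "alt4 x y z w \<longleftrightarrow> (\<exists>a b c d e f g h. orient x a b \<and> orient y c d \<and> orient z e f \<and> orient w g h \<and>
     adj b c \<and> adj d e \<and> adj f g \<and> adj h a)"

text \<open>
  \<open>span W R\<close> is a hypertree on \<open>W\<close>: its hyperedges are alternating 6- and 8-cycles that meet
  three or four components in one edge each, and \<open>R\<close> collects the factor edges they remove.
  The added edges need no bookkeeping, since they connect different cycles of the factor.
\<close>

inductive span :: "tree set \<Rightarrow> (tree \<times> addr) set \<Rightarrow> bool" where
  span_single: "span {w} {}"
| span_join3: "\<lbrakk>span W1 R1; span W2 R2; span W3 R3;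
     W1 \<inter> W2 = {}; W1 \<inter> W3 = {}; W2 \<inter> W3 = {};
     fst x1 \<in> W1; fst x2 \<in> W2; fst x3 \<in> W3; x1 \<notin> R1; x2 \<notin> R2; x3 \<notin> R3; alt3 x1 x2 x3\<rbrakk>
    \<Longrightarrow> span (W1 \<union> W2 \<union> W3) (R1 \<union> R2 \<union> R3 \<union> {x1, x2, x3})"
| span_join4: "\<lbrakk>span W1 R1; span W2 R2; span W3 R3; span W4 R4;
     W1 \<inter> W2 = {}; W1 \<inter> W3 = {}; W1 \<inter> W4 = {}; W2 \<inter> W3 = {}; W2 \<inter> W4 = {}; W3 \<inter> W4 = {};
     fst x1 \<in> W1; fst x2 \<in> W2; fst x3 \<in> W3; fst x4 \<in> W4;
     x1 \<notin> R1; x2 \<notin> R2; x3 \<notin> R3; x4 \<notin> R4; alt4 x1 x2 x3 x4\<rbrakk>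
    \<Longrightarrow> span (W1 \<union> W2 \<union> W3 \<union> W4) (R1 \<union> R2 \<union> R3 \<union> R4 \<union> {x1, x2, x3, x4})"

section \<open>Lifting joins and hypertrees to rows and columns\<close>

lemma orient_row: "orient (w, e) a b \<Longrightarrow> orient (Node u w, Ri e) (row u a) (row u b)"
  by (auto simp: orient_def)

lemma orient_col: "orient (w, e) a b \<Longrightarrow> orient (Node w v, Le e) (col v a) (col v b)"
  by (auto simp: orient_def)

definition lift_row :: "tree \<Rightarrow> tree \<times> addr \<Rightarrow> tree \<times> addr" where
  "lift_row u = (\<lambda>(w, e). (Node u w, Ri e))"

definition lift_col :: "tree \<Rightarrow> tree \<times> addr \<Rightarrow> tree \<times> addr" where
  "lift_col v = (\<lambda>(w, e). (Node w v, Le e))"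

lemma orient_lift_row: "orient x a b \<Longrightarrow> orient (lift_row u x) (row u a) (row u b)"
  by (cases x) (simp add: lift_row_def orient_row)

lemma orient_lift_col: "orient x a b \<Longrightarrow> orient (lift_col v x) (col v a) (col v b)"
  by (cases x) (simp add: lift_col_def orient_col)

lemma alt3_lift_row: "alt3 x y z \<Longrightarrow> alt3 (lift_row u x) (lift_row u y) (lift_row u z)"
  unfolding alt3_def by (meson orient_lift_row adj_row)

lemma alt3_lift_col: "alt3 x y z \<Longrightarrow> alt3 (lift_col u x) (lift_col u y) (lift_col u z)"
  unfolding alt3_def by (meson orient_lift_col adj_col)

lemma alt4_lift_row: "alt4 x y z w \<Longrightarrow> alt4 (lift_row u x) (lift_row u y) (lift_row u z) (lift_row u w)"
  unfolding alt4_def by (meson orient_lift_row adj_row)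

lemma alt4_lift_col: "alt4 x y z w \<Longrightarrow> alt4 (lift_col u x) (lift_col u y) (lift_col u z) (lift_col u w)"
  unfolding alt4_def by (meson orient_lift_col adj_col)

lemma lift_row_inject [simp]: "lift_row u x = lift_row u' y \<longleftrightarrow> u = u' \<and> x = y"
  by (cases x; cases y) (auto simp: lift_row_def)

lemma lift_col_inject [simp]: "lift_col u x = lift_col u' y \<longleftrightarrow> u = u' \<and> x = y"
  by (cases x; cases y) (auto simp: lift_col_def)

lemma fst_lift_row [simp]: "fst (lift_row u x) = Node u (fst x)"
  by (cases x) (simp add: lift_row_def)

lemma fst_lift_col [simp]: "fst (lift_col v x) = Node (fst x) v"
  by (cases x) (simp add: lift_col_def)

lemma span_lift_row: "span W R \<Longrightarrow> span (Node u ` W) (lift_row u ` R)"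
proof (induction rule: span.induct)
  case (span_single w)
  then show ?case by (simp add: span.span_single)
next
  case (span_join3 W1 R1 W2 R2 W3 R3 x1 x2 x3)
  then show ?case
    unfolding image_Un image_insert image_empty
    by (intro span.span_join3) (auto intro: alt3_lift_row)
next
  case (span_join4 W1 R1 W2 R2 W3 R3 W4 R4 x1 x2 x3 x4)
  then show ?case
    unfolding image_Un image_insert image_empty
    by (intro span.span_join4) (auto intro: alt4_lift_row)
qed

lemma span_lift_col: "span W R \<Longrightarrow> span ((\<lambda>u. Node u v) ` W) (lift_col v ` R)"
proof (induction rule: span.induct)
  case (span_single w)
  then show ?case by (simp add: span.span_single)
next
  case (span_join3 W1 R1 W2 R2 W3 R3 x1 x2 x3)
  then show ?case
    unfolding image_Un image_insert image_empty
    by (intro span.span_join3) (auto intro: alt3_lift_col)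
next
  case (span_join4 W1 R1 W2 R2 W3 R3 W4 R4 x1 x2 x3 x4)
  then show ?case
    unfolding image_Un image_insert image_empty
    by (intro span.span_join4) (auto intro: alt4_lift_col)
qed

lemma span_fst: "span W R \<Longrightarrow> x \<in> R \<Longrightarrow> fst x \<in> W"
  by (induction rule: span.induct) auto

lemma span_finite: "span W R \<Longrightarrow> finite W"
  by (induction rule: span.induct) auto

lemma span_valid: "span W R \<Longrightarrow> x \<in> R \<Longrightarrow> valid (fst x) (snd x)"
  by (induction rule: span.induct) (auto simp: alt3_def alt4_def orient_def)

text \<open>Substitution of hypertrees: every node \<open>t\<close> of the hypertree
  \<open>S\<close> is blown up to a component \<open>W t\<close> in which \<open>t\<close> itself
  still carries the edges of \<open>S\<close>. Since the components are disjoint, it is enough that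
  these edges avoid \<open>R t\<close>.\<close>

lemma span_compose:
  assumes "span U S"
    and "\<And>t. t \<in> U \<Longrightarrow> span (W t) (R t) \<and> t \<in> W t"
    and "\<And>t a. (t, a) \<in> S \<Longrightarrow> (t, a) \<notin> R t"
    and "\<And>t t'. t \<in> U \<Longrightarrow> t' \<in> U \<Longrightarrow> t \<noteq> t' \<Longrightarrow> W t \<inter> W t' = {}"
  shows "span (\<Union>t\<in>U. W t) (S \<union> (\<Union>t\<in>U. R t))"
  using assms
proof (induction rule: span.induct)
  case (span_single w)
  then show ?case by simp
next
  case (span_join3 U1 S1 U2 S2 U3 S3 x1 x2 x3)
  let ?R = "\<lambda>U S. S \<union> (\<Union>t\<in>U. R t)"
  have s: "span (\<Union>t\<in>U1. W t) (?R U1 S1)" "span (\<Union>t\<in>U2. W t) (?R U2 S2)"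
    "span (\<Union>t\<in>U3. W t) (?R U3 S3)"
    using span_join3.prems by (intro span_join3.IH; auto)+
  have fst_in: "t' = t" if "t \<in> U1 \<union> U2 \<union> U3" "x \<in> R t" "fst x = t'" "t' \<in> U1 \<union> U2 \<union> U3" for t t' x
  proof (rule ccontr)
    assume "t' \<noteq> t"
    then have "W t \<inter> W t' = {}" using span_join3.prems(3) that by blast
    moreover have "t' \<in> W t" using span_fst span_join3.prems(1) that by blast
    moreover have "t' \<in> W t'" using span_join3.prems(1) that by blast
    ultimately show False by blast
  qed
  have notin: "x \<notin> (\<Union>t\<in>U'. R t)" if "x \<in> {x1, x2, x3}" "U' \<subseteq> U1 \<union> U2 \<union> U3" for x U'
  proof
    assume "x \<in> (\<Union>t\<in>U'. R t)"
    then obtain t where t: "t \<in> U'" "x \<in> R t" by blast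
    have "fst x \<in> U1 \<union> U2 \<union> U3" using that(1) span_join3.hyps by blast
    then have "fst x = t" using fst_in t that(2) by blast
    moreover have "(fst x, snd x) \<notin> R (fst x)" using span_join3.prems(2)[of "fst x" "snd x"] that(1) by auto
    ultimately show False using t by (metis prod.collapse)
  qed
  have disj: "(\<Union>t\<in>A. W t) \<inter> (\<Union>t\<in>B. W t) = {}"
    if "A \<inter> B = {}" "A \<subseteq> U1 \<union> U2 \<union> U3" "B \<subseteq> U1 \<union> U2 \<union> U3" for A B
    using that span_join3.prems(3) by blast
  have mem: "fst x \<in> (\<Union>t\<in>A. W t)" if "fst x \<in> A" "A \<subseteq> U1 \<union> U2 \<union> U3" for x :: "tree \<times> addr" and A
    using that span_join3.prems(1) by blast
  have d: "(\<Union>t\<in>U1. W t) \<inter> (\<Union>t\<in>U2. W t) = {}" "(\<Union>t\<in>U1. W t) \<inter> (\<Union>t\<in>U3. W t) = {}" "(\<Union>t\<in>U2. W t) \<inter> (\<Union>t\<in>U3. W t) = {}"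
    using span_join3.hyps by (intro disj; blast)+
  have m: "fst x1 \<in> (\<Union>t\<in>U1. W t)" "fst x2 \<in> (\<Union>t\<in>U2. W t)" "fst x3 \<in> (\<Union>t\<in>U3. W t)"
    using span_join3.hyps by (intro mem; blast)+
  have n: "x1 \<notin> ?R U1 S1" "x2 \<notin> ?R U2 S2" "x3 \<notin> ?R U3 S3"
    using notin[of x1 U1] notin[of x2 U2] notin[of x3 U3] span_join3.hyps by blast+
  have "span ((\<Union>t\<in>U1. W t) \<union> (\<Union>t\<in>U2. W t) \<union> (\<Union>t\<in>U3. W t))
     (?R U1 S1 \<union> ?R U2 S2 \<union> ?R U3 S3 \<union> {x1, x2, x3})"
    by (rule span.span_join3[OF s d m n span_join3.hyps(13)])
  moreover have "?R U1 S1 \<union> ?R U2 S2 \<union> ?R U3 S3 \<union> {x1, x2, x3} =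
    ?R (U1 \<union> U2 \<union> U3) (S1 \<union> S2 \<union> S3 \<union> {x1, x2, x3})" by blast
  moreover have "(\<Union>t\<in>U1. W t) \<union> (\<Union>t\<in>U2. W t) \<union> (\<Union>t\<in>U3. W t) = (\<Union>t\<in>U1 \<union> U2 \<union> U3. W t)"
    by blast
  ultimately show ?case by (simp only:)
next
  case (span_join4 U1 S1 U2 S2 U3 S3 U4 S4 x1 x2 x3 x4)
  let ?R = "\<lambda>U S. S \<union> (\<Union>t\<in>U. R t)" and ?U = "U1 \<union> U2 \<union> U3 \<union> U4"
  have s: "span (\<Union>t\<in>U1. W t) (?R U1 S1)" "span (\<Union>t\<in>U2. W t) (?R U2 S2)"
    "span (\<Union>t\<in>U3. W t) (?R U3 S3)" "span (\<Union>t\<in>U4. W t) (?R U4 S4)"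
    using span_join4.prems by (intro span_join4.IH; auto)+
  have fst_in: "t' = t" if "t \<in> ?U" "x \<in> R t" "fst x = t'" "t' \<in> ?U" for t t' x
  proof (rule ccontr)
    assume "t' \<noteq> t"
    then have "W t \<inter> W t' = {}" using span_join4.prems(3) that by blast
    moreover have "t' \<in> W t" using span_fst span_join4.prems(1) that by blast
    moreover have "t' \<in> W t'" using span_join4.prems(1) that by blast
    ultimately show False by blast
  qed
  have notin: "x \<notin> (\<Union>t\<in>U'. R t)" if "x \<in> {x1, x2, x3, x4}" "U' \<subseteq> ?U" for x U'
  proof
    assume "x \<in> (\<Union>t\<in>U'. R t)"
    then obtain t where t: "t \<in> U'" "x \<in> R t" by blast
    have "fst x \<in> ?U" using that(1) span_join4.hyps by blast
    then have "fst x = t" using fst_in t that(2) by blast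
    moreover have "(fst x, snd x) \<notin> R (fst x)" using span_join4.prems(2)[of "fst x" "snd x"] that(1) by auto
    ultimately show False using t by (metis prod.collapse)
  qed
  have disj: "(\<Union>t\<in>A. W t) \<inter> (\<Union>t\<in>B. W t) = {}"
    if "A \<inter> B = {}" "A \<subseteq> ?U" "B \<subseteq> ?U" for A B
    using that span_join4.prems(3) by blast
  have mem: "fst x \<in> (\<Union>t\<in>A. W t)" if "fst x \<in> A" "A \<subseteq> ?U" for x :: "tree \<times> addr" and A
    using that span_join4.prems(1) by blast
  have d: "(\<Union>t\<in>U1. W t) \<inter> (\<Union>t\<in>U2. W t) = {}" "(\<Union>t\<in>U1. W t) \<inter> (\<Union>t\<in>U3. W t) = {}" "(\<Union>t\<in>U1. W t) \<inter> (\<Union>t\<in>U4. W t) = {}" "(\<Union>t\<in>U2. W t) \<inter> (\<Union>t\<in>U3. W t) = {}" "(\<Union>t\<in>U2. W t) \<inter> (\<Union>t\<in>U4. W t) = {}" "(\<Union>t\<in>U3. W t) \<inter> (\<Union>t\<in>U4. W t) = {}"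
    using span_join4.hyps by (intro disj; blast)+
  have m: "fst x1 \<in> (\<Union>t\<in>U1. W t)" "fst x2 \<in> (\<Union>t\<in>U2. W t)" "fst x3 \<in> (\<Union>t\<in>U3. W t)" "fst x4 \<in> (\<Union>t\<in>U4. W t)"
    using span_join4.hyps by (intro mem; blast)+
  have n: "x1 \<notin> ?R U1 S1" "x2 \<notin> ?R U2 S2" "x3 \<notin> ?R U3 S3" "x4 \<notin> ?R U4 S4"
    using notin[of x1 U1] notin[of x2 U2] notin[of x3 U3] notin[of x4 U4] span_join4.hyps by blast+
  have "span ((\<Union>t\<in>U1. W t) \<union> (\<Union>t\<in>U2. W t) \<union> (\<Union>t\<in>U3. W t) \<union> (\<Union>t\<in>U4. W t))
     (?R U1 S1 \<union> ?R U2 S2 \<union> ?R U3 S3 \<union> ?R U4 S4 \<union> {x1, x2, x3, x4})"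
    by (rule span.span_join4[OF s d m n span_join4.hyps(19)])
  moreover have "?R U1 S1 \<union> ?R U2 S2 \<union> ?R U3 S3 \<union> ?R U4 S4 \<union> {x1, x2, x3, x4} =
    ?R ?U (S1 \<union> S2 \<union> S3 \<union> S4 \<union> {x1, x2, x3, x4})" by blast
  moreover have "(\<Union>t\<in>U1. W t) \<union> (\<Union>t\<in>U2. W t) \<union> (\<Union>t\<in>U3. W t) \<union> (\<Union>t\<in>U4. W t) = (\<Union>t\<in>?U. W t)"
    by blast
  ultimately show ?case by (simp only:)
qed

section \<open>From hypertrees to Hamilton cycles on the two layers\<close>

definition verts :: "tree set \<Rightarrow> bool list set" where
  "verts W = (\<Union>t\<in>W. set (path t))"

lemma verts_Un: "verts (W \<union> W') = verts W \<union> verts W'"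
  by (auto simp: verts_def)

lemma verts_disjoint: "W \<inter> W' = {} \<Longrightarrow> verts W \<inter> verts W' = {}"
  using path_inject by (auto simp: verts_def)

lemma edge_subset_verts: "valid t a \<Longrightarrow> t \<in> W \<Longrightarrow> edge t a \<subseteq> verts W"
  using edge_subset_path by (fastforce simp: verts_def)

text \<open>The last clause makes \<open>R\<close> recoverable from \<open>C\<close>, which is what the counting uses.\<close>

definition keeps :: "tree set \<Rightarrow> (tree \<times> addr) set \<Rightarrow> bool list set set \<Rightarrow> bool" where
  "keeps W R C \<longleftrightarrow> C \<subseteq> state_edges \<and> C \<subseteq> Pow (verts W) \<and> fst ` R \<subseteq> W \<and>
     (\<forall>t\<in>W. \<forall>a. valid t a \<longrightarrow> (edge t a \<in> C \<longleftrightarrow> (t, a) \<notin> R))"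

definition span_path where
  "span_path W R P a b \<longleftrightarrow> ham_path (verts W) P a b \<and> keeps W R P"

definition span_cycle where
  "span_cycle W R C \<longleftrightarrow> hamilton_cycle (verts W) state_edges C \<and> keeps W R C"

lemma orient_edge: "orient x a b \<Longrightarrow> edge (fst x) (snd x) = {a, b}"
  by (auto simp: orient_def edge_def)

lemma orient_in_verts: "orient x a b \<Longrightarrow> fst x \<in> W \<Longrightarrow> a \<in> verts W \<and> b \<in> verts W"
  using edge_subset_verts[of "fst x" "snd x" W] orient_edge[of x a b] by (auto simp: orient_def)

lemma span_cycle_open:
  assumes "span_cycle W R C" "orient x a b" "fst x \<in> W" "x \<notin> R"
  shows "span_path W (insert x R) (C - {{a, b}}) a b"
proof -
  have v: "valid (fst x) (snd x)" using assms(2) by (simp add: orient_def)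
  have e: "edge (fst x) (snd x) = {a, b}" by (rule orient_edge[OF assms(2)])
  have "{a, b} \<in> C" using assms(1,3,4) v e unfolding span_cycle_def keeps_def by force
  then have "ham_path (verts W) (C - {{a, b}}) a b"
    using assms(1) hamilton_cycle_open[of "verts W" state_edges C a b] by (simp add: span_cycle_def)
  moreover have "edge t s = {a, b} \<longleftrightarrow> (t, s) = x" if "valid t s" for t s
    using edge_inject_tree[OF that v] e by (cases x) auto
  ultimately show ?thesis
    using assms(1,3) unfolding span_path_def span_cycle_def keeps_def by auto
qed

text \<open>A factor edge stays within one path. Hence added edges never restore a removed factor
  edge, and \<open>keeps\<close> survives every join.\<close>

lemma cross_edge_not_edge:
  assumes "b \<in> verts W1" "c \<in> verts W2" "W1 \<inter> W2 = {}" "valid t s"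
  shows "edge t s \<noteq> {b, c}"
proof
  assume "edge t s = {b, c}"
  then have "b \<in> set (path t)" "c \<in> set (path t)" using edge_subset_path[OF assms(4)] by auto
  moreover obtain t1 t2 where "t1 \<in> W1" "b \<in> set (path t1)" "t2 \<in> W2" "c \<in> set (path t2)"
    using assms(1,2) by (auto simp: verts_def)
  ultimately show False using path_inject assms(3) by blast
qed

lemma keeps_Un:
  assumes "keeps W1 R1 P1" "keeps W2 R2 P2" "W1 \<inter> W2 = {}"
  shows "keeps (W1 \<union> W2) (R1 \<union> R2) (P1 \<union> P2)"
proof -
  have *: "edge t a \<notin> P" "(t, a) \<notin> R"
    if "keeps W R P" "t \<in> W'" "valid t a" "W \<inter> W' = {}" for t a W W' R P
  proof -
    have "edge t a \<subseteq> verts W'" by (rule edge_subset_verts[OF that(3,2)])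
    moreover have "verts W \<inter> verts W' = {}" by (rule verts_disjoint[OF that(4)])
    moreover have "edge t a \<noteq> {}" by simp
    ultimately have "\<not> edge t a \<subseteq> verts W" by blast
    then show "edge t a \<notin> P" using that(1) by (auto simp: keeps_def)
    show "(t, a) \<notin> R" using that by (force simp: keeps_def)
  qed
  show ?thesis
    unfolding keeps_def
  proof (intro conjI ballI allI impI)
    show "P1 \<union> P2 \<subseteq> state_edges" "P1 \<union> P2 \<subseteq> Pow (verts (W1 \<union> W2))" "fst ` (R1 \<union> R2) \<subseteq> W1 \<union> W2"
      using assms(1,2) by (auto simp: keeps_def verts_Un)
  next
    fix t a assume t: "t \<in> W1 \<union> W2" and v: "valid t a"
    show "edge t a \<in> P1 \<union> P2 \<longleftrightarrow> (t, a) \<notin> R1 \<union> R2"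
    proof (cases "t \<in> W1")
      case True
      with *[OF assms(2) True v] assms(1,3) v show ?thesis by (auto simp: keeps_def)
    next
      case False
      with t have "t \<in> W2" by blast
      with *[OF assms(1) this v] assms(2,3) v show ?thesis by (auto simp: keeps_def)
    qed
  qed
qed

lemma keeps_insert:
  assumes "keeps W R P" "adj b c" "b \<in> verts W" "c \<in> verts W"
    and "\<And>t s. valid t s \<Longrightarrow> edge t s \<noteq> {b, c}"
  shows "keeps W R (insert {b, c} P)"
proof -
  have "{b, c} \<in> state_edges" using assms(2) by (auto simp: state_edges_def)
  with assms show ?thesis unfolding keeps_def by auto
qed

lemma span_path_join:
  assumes "span_path W1 R1 P1 a b" "span_path W2 R2 P2 c d" "W1 \<inter> W2 = {}" "adj b c"
    and "b \<in> verts W1" "c \<in> verts W2"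
  shows "span_path (W1 \<union> W2) (R1 \<union> R2) (insert {b, c} (P1 \<union> P2)) a d"
proof -
  have "ham_path (verts (W1 \<union> W2)) (insert {b, c} (P1 \<union> P2)) a d"
    using assms(1,2) verts_disjoint[OF assms(3)]
      ham_path_join[of "verts W1" P1 a b "verts W2" P2 c d] by (simp add: span_path_def verts_Un)
  moreover have "keeps (W1 \<union> W2) (R1 \<union> R2) (insert {b, c} (P1 \<union> P2))"
    using assms cross_edge_not_edge[OF assms(5,6,3)]
    by (intro keeps_insert keeps_Un) (auto simp: span_path_def verts_Un)
  ultimately show ?thesis by (simp add: span_path_def)
qed

lemma span_path_close:
  assumes "span_path W R P a b" "adj b a" "finite W" "t \<in> W" "t \<noteq> Leaf"
    and "a \<in> verts W1" "b \<in> verts W2" "W1 \<inter> W2 = {}" "W1 \<subseteq> W" "W2 \<subseteq> W"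
  shows "span_cycle W R (insert {b, a} P)"
proof -
  have in_verts: "a \<in> verts W" "b \<in> verts W" using assms(6,7,9,10) by (auto simp: verts_def)
  have "edge t' s \<noteq> {b, a}" if "valid t' s" for t' s
    using cross_edge_not_edge[OF assms(6,7,8) that] by (simp add: insert_commute)
  then have k: "keeps W R (insert {b, a} P)"
    using assms(1,2) in_verts by (intro keeps_insert) (auto simp: span_path_def)
  have "3 \<le> card (set (path t))"
  proof -
    have "0 < size t" using assms(5) by (cases t) simp_all
    then show ?thesis using distinct_card[OF distinct_path[of t]] length_path[of t] by simp
  qed
  also have "\<dots> \<le> card (verts W)"
    using assms(3,4) by (intro card_mono) (auto simp: verts_def)
  finally have "hamilton_cycle (verts W) state_edges (insert {b, a} P)"
    using assms(1) k by (intro ham_path_close) (auto simp: span_path_def keeps_def)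
  with k show ?thesis by (simp add: span_cycle_def)
qed

lemma walk_edges_path_subset: "walk_edges (path t) \<subseteq> state_edges"
proof
  fix e assume "e \<in> walk_edges (path t)"
  then obtain a where "valid t a" "e = edge t a" using walk_is_edge by blast
  then show "e \<in> state_edges" using edge_adj by (auto simp: edge_def state_edges_def)
qed

lemma span_cycle_single:
  assumes "t \<noteq> Leaf"
  shows "span_cycle {t} {} (closed_tour_edges (path t))"
proof -
  have c: "closed_tour_edges (path t) = insert {neg (word t), word t} (walk_edges (path t))"
    by (simp add: closed_tour_edges_conv)
  have sub: "closed_tour_edges (path t) \<subseteq> state_edges"
    unfolding c using walk_edges_path_subset by (auto simp: state_edges_def insert_commute)
  have "3 \<le> length (path t)" using assms by (cases t) (auto simp: length_path)
  then have "hamilton_cycle (set (path t)) state_edges (closed_tour_edges (path t))"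
    using sub distinct_path unfolding hamilton_cycle_def by blast
  moreover have "keeps {t} {} (closed_tour_edges (path t))"
    using sub walk_edges_subset[of _ "path t"] edge_in_walk by (auto simp: keeps_def c verts_def)
  ultimately show ?thesis by (simp add: span_cycle_def verts_def)
qed

text \<open>The cycle of each component is opened at its edge of the alternating cycle. The
  resulting Hamilton paths from \<open>a\<close> to \<open>b\<close>, \<open>c\<close> to
  \<open>d\<close>, and so on are strung together by the added edges, the last of which closes the
  tour. \<open>Leaf\<close> is excluded because its path is a single vertex.\<close>

lemma span_has_cycle: "span W R \<Longrightarrow> Leaf \<notin> W \<Longrightarrow> \<exists>C. span_cycle W R C"
proof (induction rule: span.induct)
  case (span_single w)
  then show ?case using span_cycle_single[of w] by auto
next
  case (span_join3 W1 R1 W2 R2 W3 R3 x1 x2 x3)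
  then obtain C1 C2 C3 where C: "span_cycle W1 R1 C1" "span_cycle W2 R2 C2" "span_cycle W3 R3 C3" by auto
  from \<open>alt3 x1 x2 x3\<close> obtain a b c d e f where
    o: "orient x1 a b" "orient x2 c d" "orient x3 e f" and adj: "adj b c" "adj d e" "adj f a"
    unfolding alt3_def by blast
  note in_verts = orient_in_verts[OF o(1) \<open>fst x1 \<in> W1\<close>] orient_in_verts[OF o(2) \<open>fst x2 \<in> W2\<close>]
    orient_in_verts[OF o(3) \<open>fst x3 \<in> W3\<close>]
  obtain P1 P2 P3 where P: "span_path W1 (insert x1 R1) P1 a b" "span_path W2 (insert x2 R2) P2 c d"
    "span_path W3 (insert x3 R3) P3 e f"
    using span_cycle_open[OF C(1) o(1)] span_cycle_open[OF C(2) o(2)] span_cycle_open[OF C(3) o(3)] span_join3.hyps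
    by blast
  obtain Q where Q: "span_path (W1 \<union> W2) (insert x1 R1 \<union> insert x2 R2) Q a d"
    using span_path_join[OF P(1,2) _ adj(1)] span_join3.hyps in_verts by blast
  obtain Q' where Q': "span_path (W1 \<union> W2 \<union> W3) (insert x1 R1 \<union> insert x2 R2 \<union> insert x3 R3) Q' a f"
    using span_path_join[OF Q P(3) _ adj(2)] span_join3.hyps in_verts verts_Un by blast
  have "\<exists>C. span_cycle (W1 \<union> W2 \<union> W3) (insert x1 R1 \<union> insert x2 R2 \<union> insert x3 R3) C"
    by (rule exI, rule span_path_close[OF Q' adj(3), of "fst x1" W1 W3])
      (use span_join3.hyps span_join3.prems in_verts span_finite in auto)
  moreover have "insert x1 R1 \<union> insert x2 R2 \<union> insert x3 R3 = R1 \<union> R2 \<union> R3 \<union> {x1, x2, x3}" by blast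
  ultimately show ?case by simp
next
  case (span_join4 W1 R1 W2 R2 W3 R3 W4 R4 x1 x2 x3 x4)
  then obtain C1 C2 C3 C4 where
    C: "span_cycle W1 R1 C1" "span_cycle W2 R2 C2" "span_cycle W3 R3 C3" "span_cycle W4 R4 C4" by auto
  from \<open>alt4 x1 x2 x3 x4\<close> obtain a b c d e f g h where
    o: "orient x1 a b" "orient x2 c d" "orient x3 e f" "orient x4 g h" and
    adj: "adj b c" "adj d e" "adj f g" "adj h a"
    unfolding alt4_def by blast
  note in_verts = orient_in_verts[OF o(1) \<open>fst x1 \<in> W1\<close>] orient_in_verts[OF o(2) \<open>fst x2 \<in> W2\<close>]
    orient_in_verts[OF o(3) \<open>fst x3 \<in> W3\<close>] orient_in_verts[OF o(4) \<open>fst x4 \<in> W4\<close>]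
  obtain P1 P2 P3 P4 where P: "span_path W1 (insert x1 R1) P1 a b" "span_path W2 (insert x2 R2) P2 c d"
    "span_path W3 (insert x3 R3) P3 e f" "span_path W4 (insert x4 R4) P4 g h"
    using span_cycle_open[OF C(1) o(1)] span_cycle_open[OF C(2) o(2)] span_cycle_open[OF C(3) o(3)]
      span_cycle_open[OF C(4) o(4)] span_join4.hyps
    by blast
  obtain Q where Q: "span_path (W1 \<union> W2) (insert x1 R1 \<union> insert x2 R2) Q a d"
    using span_path_join[OF P(1,2) _ adj(1)] span_join4.hyps in_verts by blast
  obtain Q' where Q': "span_path (W1 \<union> W2 \<union> W3) (insert x1 R1 \<union> insert x2 R2 \<union> insert x3 R3) Q' a f"
    using span_path_join[OF Q P(3) _ adj(2)] span_join4.hyps in_verts verts_Un by blast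
  obtain Q'' where Q'': "span_path (W1 \<union> W2 \<union> W3 \<union> W4)
      (insert x1 R1 \<union> insert x2 R2 \<union> insert x3 R3 \<union> insert x4 R4) Q'' a h"
    using span_path_join[OF Q' P(4) _ adj(3)] span_join4.hyps in_verts verts_Un by blast
  have "\<exists>C. span_cycle (W1 \<union> W2 \<union> W3 \<union> W4) (insert x1 R1 \<union> insert x2 R2 \<union> insert x3 R3 \<union> insert x4 R4) C"
    by (rule exI, rule span_path_close[OF Q'' adj(4), of "fst x1" W1 W4])
      (use span_join4.hyps span_join4.prems in_verts span_finite in auto)
  moreover have "insert x1 R1 \<union> insert x2 R2 \<union> insert x3 R3 \<union> insert x4 R4
    = R1 \<union> R2 \<union> R3 \<union> R4 \<union> {x1, x2, x3, x4}" by blast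
  ultimately show ?case by simp
qed

section \<open>Transfer to the odd graph\<close>

definition vertex :: "bool list \<Rightarrow> nat set" where
  "vertex s = (if ht s = 0 then Suc ` {i. i < length s \<and> \<not> s ! i}
     else insert (Suc (length s)) (Suc ` {i. i < length s \<and> s ! i}))"

lemma ht_conv_card: "ht s = 2 * int (card {i. i < length s \<and> s ! i}) - int (length s)"
proof -
  have "ht s = 2 * int (length (filter (\<lambda>b. b) s)) - int (length s)"
    by (induction s) auto
  then show ?thesis by (simp add: length_filter_conv_card)
qed

lemma card_False_positions:
  "card {i. i < length s \<and> \<not> s ! i} = length s - card {i. i < length s \<and> s ! i}"
proof -
  have "{i. i < length s \<and> \<not> s ! i} = {..<length s} - {i. i < length s \<and> s ! i}" by auto
  then show ?thesis by (simp add: card_Diff_subset Collect_conj_eq lessThan_def)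
qed

lemma vertex_in_verts:
  assumes "s \<in> states k" "k \<ge> 1"
  shows "vertex s \<in> odd_graph_verts k"
proof (cases "ht s = 0")
  case True
  then have "card {i. i < length s \<and> \<not> s ! i} = k"
    using assms ht_conv_card[of s] card_False_positions[of s] by (simp add: states_def)
  then have "card (vertex s) = k" using True by (simp add: vertex_def card_image)
  then show ?thesis using True assms by (auto simp: kneser_verts_def vertex_def states_def)
next
  case False
  then have "ht s = -2" "length s = 2 * k" using assms(1) by (simp_all add: states_def)
  then have "int (card {i. i < length s \<and> s ! i}) = int k - 1"
    using ht_conv_card[of s] by simp
  then have "card {i. i < length s \<and> s ! i} = k - 1" by simp
  moreover have "Suc (length s) \<notin> Suc ` {i. i < length s \<and> s ! i}" by auto
  ultimately have "card (vertex s) = k" using False assms(2) by (simp add: vertex_def card_image)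
  then show ?thesis using False assms by (auto simp: kneser_verts_def vertex_def states_def)
qed

lemma vertex_last_iff: "s \<in> states k \<Longrightarrow> 2 * k + 1 \<in> vertex s \<longleftrightarrow> ht s \<noteq> 0"
  by (auto simp: vertex_def states_def)

lemma Suc_in_vertex:
  "s \<in> states k \<Longrightarrow> i < 2 * k \<Longrightarrow> Suc i \<in> vertex s \<longleftrightarrow> (s ! i \<longleftrightarrow> ht s \<noteq> 0)"
  by (auto simp: vertex_def states_def)

lemma inj_on_vertex: "inj_on vertex (states k)"
proof
  fix s t assume st: "s \<in> states k" "t \<in> states k" "vertex s = vertex t"
  then have "ht s = 0 \<longleftrightarrow> ht t = 0" using vertex_last_iff by blast
  then have "s ! i = t ! i" if "i < 2 * k" for i
    using st Suc_in_vertex that by metis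
  then show "s = t" using st by (intro nth_equalityI) (auto simp: states_def)
qed

lemma vertex_surj:
  assumes "A \<in> odd_graph_verts k" "k \<ge> 1"
  shows "A \<in> vertex ` states k"
proof -
  have A: "A \<subseteq> {1..2 * k + 1}" "card A = k" "finite A"
    using assms finite_subset by (auto simp: kneser_verts_def)
  define b where "b \<longleftrightarrow> 2 * k + 1 \<in> A"
  define s where "s = map (\<lambda>i. Suc i \<in> A \<longleftrightarrow> b) [0..<2 * k]"
  have len: "length s = 2 * k" by (simp add: s_def)
  have nth: "s ! i \<longleftrightarrow> (Suc i \<in> A \<longleftrightarrow> b)" if "i < 2 * k" for i using that by (simp add: s_def)
  have img: "Suc ` {i. i < 2 * k \<and> Suc i \<in> A} = A - {2 * k + 1}"
  proof
    show "A - {2 * k + 1} \<subseteq> Suc ` {i. i < 2 * k \<and> Suc i \<in> A}"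
    proof
      fix x assume "x \<in> A - {2 * k + 1}"
      then have "x = Suc (x - 1)" "x - 1 < 2 * k" "Suc (x - 1) \<in> A" using A(1) by force+
      then show "x \<in> Suc ` {i. i < 2 * k \<and> Suc i \<in> A}" by blast
    qed
  qed auto
  then have c: "card {i. i < 2 * k \<and> Suc i \<in> A} = card (A - {2 * k + 1})"
    by (metis card_image inj_Suc)
  show ?thesis
  proof (cases b)
    case True
    have e: "{i. i < length s \<and> s ! i} = {i. i < 2 * k \<and> Suc i \<in> A}" using True nth len by auto
    have "card (A - {2 * k + 1}) = k - 1" using True A by (simp add: b_def)
    then have ht: "ht s = -2" using ht_conv_card[of s] e c len assms(2) by simp
    then have "vertex s = A" using e img True len by (auto simp: vertex_def b_def)
    moreover have "s \<in> states k" using ht len by (simp add: states_def)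
    ultimately show ?thesis by blast
  next
    case False
    have e: "{i. i < length s \<and> \<not> s ! i} = {i. i < 2 * k \<and> Suc i \<in> A}" using False nth len by auto
    have "A - {2 * k + 1} = A" using False by (simp add: b_def)
    then have "card {i. i < length s \<and> \<not> s ! i} = k" using e c A by simp
    moreover have "card {i. i < length s \<and> s ! i} \<le> card {..<length s}"
      by (rule card_mono) auto
    ultimately have "card {i. i < length s \<and> s ! i} = k"
      using card_False_positions[of s] len by simp
    then have ht: "ht s = 0" using ht_conv_card[of s] len by simp
    then have "vertex s = A" using e img \<open>A - {2 * k + 1} = A\<close> by (simp add: vertex_def)
    moreover have "s \<in> states k" using ht len by (simp add: states_def)
    ultimately show ?thesis by blast
  qed
qed

lemma vertex_image_states: "k \<ge> 1 \<Longrightarrow> vertex ` states k = odd_graph_verts k"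
  using vertex_in_verts vertex_surj by blast

lemma adj_ht: "adj s t \<Longrightarrow> ht t = ht s + 2 \<or> ht t = ht s - 2"
  by (induction rule: adj.induct) auto

lemma adj_length: "adj s t \<Longrightarrow> length s = length t"
  by (induction rule: adj.induct) auto

lemma adj_mono: "adj s t \<Longrightarrow> ht t < ht s \<Longrightarrow> i < length s \<Longrightarrow> t ! i \<Longrightarrow> s ! i"
  by (induction arbitrary: i rule: adj.induct) (auto simp: nth_Cons split: nat.splits if_splits)

text \<open>The ones of the lower word are also ones of the upper word, and the upper word stands
  for its zeros.\<close>

lemma vertex_disjoint_lower:
  assumes "s \<in> states k" "t \<in> states k" "adj s t" "ht t < ht s"
  shows "vertex s \<inter> vertex t = {}"
proof -
  have "ht s = 0" "ht t = -2" using assms by (auto simp: states_def)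
  then show ?thesis
    using adj_mono[OF assms(3,4)] adj_length[OF assms(3)] by (auto simp: vertex_def)
qed

lemma nth_neg: "i < length s \<Longrightarrow> neg s ! i = (\<not> s ! i)"
  by (induction s arbitrary: i) (auto simp: nth_Cons split: nat.splits)

lemma vertex_disjoint_neg:
  assumes "s \<in> states k" "neg s \<in> states k"
  shows "vertex s \<inter> vertex (neg s) = {}"
proof -
  have "ht s = 0" using assms by (auto simp: states_def)
  then show ?thesis by (auto simp: vertex_def nth_neg)
qed

lemma vertex_state_edge:
  assumes "e \<in> state_edges" "e \<subseteq> states k" "k \<ge> 1"
  shows "vertex ` e \<in> odd_graph_edges k"
proof -
  consider s t where "e = {s, t}" "adj s t" | s where "e = {s, neg s}"
    using assms(1) by (auto simp: state_edges_def)
  then obtain s t where e: "e = {s, t}" and d: "vertex s \<inter> vertex t = {}"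
  proof cases
    case (1 s t)
    then have st: "s \<in> states k" "t \<in> states k" using assms(2) by auto
    have "ht t < ht s \<or> ht s < ht t" using adj_ht[OF 1(2)] by auto
    then have "vertex s \<inter> vertex t = {}"
      using vertex_disjoint_lower[OF st 1(2)] vertex_disjoint_lower[OF st(2,1) adj_sym[OF 1(2)]] by blast
    with 1 that show ?thesis by blast
  next
    case (2 s)
    then show ?thesis using that[OF 2 vertex_disjoint_neg[of s k]] assms(2) by simp
  qed
  moreover have "vertex s \<in> odd_graph_verts k" "vertex t \<in> odd_graph_verts k"
    using e assms vertex_in_verts by auto
  ultimately show ?thesis by (auto simp: kneser_edges_def)
qed

lemma closed_tour_edges_map:
  "vs \<noteq> [] \<Longrightarrow> closed_tour_edges (map f vs) = image f ` closed_tour_edges vs"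
  by (simp add: closed_tour_edges_conv last_map hd_map walk_edges_map)

lemma hamilton_cycle_image:
  assumes "hamilton_cycle V E C" "inj_on f V" "\<And>e. e \<in> C \<Longrightarrow> f ` e \<in> E'"
  shows "hamilton_cycle (f ` V) E' (image f ` C)"
proof -
  obtain vs where "distinct vs" "set vs = V" "3 \<le> length vs" "C = closed_tour_edges vs"
    using assms(1) unfolding hamilton_cycle_def by blast
  moreover from this have "vs \<noteq> []" by auto
  ultimately show ?thesis using assms(2,3) unfolding hamilton_cycle_def
    by (intro exI[of _ "map f vs"]) (auto simp: distinct_map closed_tour_edges_map)
qed

definition trees :: "nat \<Rightarrow> tree set" where
  "trees k = {t. size t = k}"

lemma verts_trees: "verts (trees k) = states k"
  using states_covered path_subset_states by (fastforce simp: verts_def trees_def)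

definition spanning :: "nat \<Rightarrow> (tree \<times> addr) set set" where
  "spanning k = {R. span (trees k) R}"

lemma finite_hamilton_cycles: "finite {C. hamilton_cycle (odd_graph_verts k) (odd_graph_edges k) C}"
proof (rule finite_subset)
  have "finite (kneser_verts n k)" for n
    by (rule finite_subset[of _ "Pow {1..n}"]) (auto simp: kneser_verts_def)
  moreover have "kneser_edges n k \<subseteq> Pow (kneser_verts n k)" for n
    by (auto simp: kneser_edges_def)
  ultimately show "finite (Pow (odd_graph_edges k))"
    by (metis finite_Pow_iff finite_subset)
  show "{C. hamilton_cycle (odd_graph_verts k) (odd_graph_edges k) C} \<subseteq> Pow (odd_graph_edges k)"
    by (auto simp: hamilton_cycle_def)
qed

lemma card_spanning_le:
  assumes "k \<ge> 1" "F \<subseteq> spanning k"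
  shows "card F \<le> card {C. hamilton_cycle (odd_graph_verts k) (odd_graph_edges k) C}"
proof -
  have "Leaf \<notin> trees k" using assms(1) by (auto simp: trees_def)
  then have "\<forall>R\<in>F. \<exists>C. span_cycle (trees k) R C"
    using span_has_cycle assms(2) by (auto simp: spanning_def)
  then obtain c where c: "\<And>R. R \<in> F \<Longrightarrow> span_cycle (trees k) R (c R)" by metis
  let ?H = "\<lambda>R. image vertex ` c R"
  have "inj_on ?H F"
  proof
    fix R R' assume R: "R \<in> F" "R' \<in> F" "?H R = ?H R'"
    have "c R \<subseteq> Pow (states k)" "c R' \<subseteq> Pow (states k)"
      using c R(1,2) by (auto simp: span_cycle_def keeps_def verts_trees)
    moreover have "inj_on (image vertex) (Pow (states k))"
      using inj_on_vertex by (rule inj_on_image_Pow)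
    ultimately have "c R = c R'" using R(3) inj_on_image_eq_iff by metis
    have "x \<in> R \<longleftrightarrow> x \<in> R'" for x
    proof (cases "fst x \<in> trees k \<and> valid (fst x) (snd x)")
      case True
      then have "edge (fst x) (snd x) \<in> c R'' \<longleftrightarrow> (fst x, snd x) \<notin> R''" if "R'' \<in> F" for R''
        using c[OF that] by (simp add: span_cycle_def keeps_def)
      from this[OF R(1)] this[OF R(2)] \<open>c R = c R'\<close> show ?thesis by simp
    next
      \<comment> \<open>Pairs that do not address a factor edge over \<open>trees k\<close> lie in
        no hypertree at all.\<close>
      case False
      moreover have "span (trees k) R" "span (trees k) R'"
        using R(1,2) assms(2) by (auto simp: spanning_def)
      ultimately show ?thesis using span_fst span_valid by blast
    qed
    then show "R = R'" by blast
  qed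
  moreover have "?H ` F \<subseteq> {C. hamilton_cycle (odd_graph_verts k) (odd_graph_edges k) C}"
  proof
    fix D assume "D \<in> ?H ` F"
    then obtain R where R: "R \<in> F" "D = ?H R" by blast
    have "hamilton_cycle (vertex ` states k) (odd_graph_edges k) (?H R)"
    proof (rule hamilton_cycle_image)
      show "hamilton_cycle (states k) state_edges (c R)"
        using c[OF R(1)] by (simp add: span_cycle_def verts_trees)
      show "vertex ` e \<in> odd_graph_edges k" if "e \<in> c R" for e
        using c[OF R(1)] that assms(1)
        by (intro vertex_state_edge) (auto simp: span_cycle_def keeps_def verts_trees)
    qed (rule inj_on_vertex)
    then show "D \<in> {C. hamilton_cycle (odd_graph_verts k) (odd_graph_edges k) C}"
      using R(2) vertex_image_states[OF assms(1)] by simp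
  qed
  ultimately show ?thesis using finite_hamilton_cycles card_inj_on_le by blast
qed

section \<open>Families of alternating cycles\<close>

abbreviation one :: tree where "one \<equiv> Node Leaf Leaf"
abbreviation left2 :: tree where "left2 \<equiv> Node one Leaf"
abbreviation right2 :: tree where "right2 \<equiv> Node Leaf one"

text \<open>The flag turns the edge around, so that a concrete alternating cycle is given by its
  edges and flags and checked by simplification.\<close>

definition oriented_ends :: "bool \<Rightarrow> tree \<times> addr \<Rightarrow> bool list \<times> bool list" where
  "oriented_ends p x = (if p then prod.swap (ends (fst x) (snd x)) else ends (fst x) (snd x))"

lemma orient_oriented_ends:
  "valid (fst x) (snd x) \<Longrightarrow> orient x (fst (oriented_ends p x)) (snd (oriented_ends p x))"
  by (auto simp: orient_def oriented_ends_def)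

lemma alt3I:
  assumes "valid (fst x) (snd x)" "valid (fst y) (snd y)" "valid (fst z) (snd z)"
    and "adj (snd (oriented_ends p x)) (fst (oriented_ends q y))"
    and "adj (snd (oriented_ends q y)) (fst (oriented_ends r z))"
    and "adj (snd (oriented_ends r z)) (fst (oriented_ends p x))"
  shows "alt3 x y z"
  unfolding alt3_def using assms orient_oriented_ends by blast

lemma alt4I:
  assumes "valid (fst x) (snd x)" "valid (fst y) (snd y)" "valid (fst z) (snd z)" "valid (fst w) (snd w)"
    and "adj (snd (oriented_ends p x)) (fst (oriented_ends q y))"
    and "adj (snd (oriented_ends q y)) (fst (oriented_ends r z))"
    and "adj (snd (oriented_ends r z)) (fst (oriented_ends s w))"
    and "adj (snd (oriented_ends s w)) (fst (oriented_ends p x))"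
  shows "alt4 x y z w"
  unfolding alt4_def using assms orient_oriented_ends by blast

lemma alt3_rotate: "alt3 x y z \<Longrightarrow> alt3 y z x"
  unfolding alt3_def by blast

lemma alt4_rotate: "alt4 x y z w \<Longrightarrow> alt4 y z w x"
  unfolding alt4_def by blast

text \<open>Attaches the two rows with left subtree of size 2 to the component of the words
  \<open>1 0 v\<close>.\<close>

lemma alt3_halves:
  "alt3 (Node right2 q, Op) (Node left2 q, Le Op) (Node Leaf (Node one q), Ri (Le Cl))"
  by (rule alt3I[where p = False and q = True and r = False])
    (simp_all add: oriented_ends_def row_def col_def adj_Cons_iff)

text \<open>The left subtrees have sizes \<open>size u + 2\<close>, \<open>size u + 1\<close> and 0:
  two consecutive sizes are attached to the words \<open>1 0 v\<close>.\<close>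

lemma alt3_consecutive:
  "alt3 (Node (Node (Node u Leaf) Leaf) q, Op) (Node (Node Leaf u) (Node Leaf q), Le Op)
     (Node Leaf (Node u (Node Leaf q)), Ri (Ri Cl))"
  by (rule alt3I[where p = False and q = True and r = True])
    (simp_all add: oriented_ends_def row_def col_def adj_Cons_iff)

text \<open>The left subtrees have sizes \<open>size u + 3\<close>, \<open>size u + 2\<close> and 1.
  This attaches the row of \<open>one\<close>, which no other family of joins for general
  \<open>k\<close> reaches.\<close>

lemma alt3_rest:
  "alt3 (Node (Node Leaf (Node (Node u Leaf) Leaf)) q, Op) (Node (Node one u) (Node Leaf q), Le (Le Cl))
     (Node one (Node u (Node Leaf q)), Ri (Ri Cl))"
  by (rule alt3I[where p = False and q = True and r = True])
    (simp_all add: oriented_ends_def row_def col_def adj_Cons_iff)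

text \<open>
  A join of three cycles preserves the parity of the number of cycles, so that a join of four
  is needed whenever the Catalan number is even.
\<close>

lemma alt4_parity:
  "alt4 (Node left2 (Node Leaf q), Le Op) (Node (Node Leaf left2) q, Op) (Node right2 (Node Leaf q), Ri Cl)
     (Node Leaf (Node one (Node Leaf q)), Ri (Le Cl))"
  by (rule alt4I[where p = False and q = True and r = False and s = True])
    (simp_all add: oriented_ends_def row_def col_def adj_Cons_iff)

text \<open>The join of four needed for the 14 trees of size 4.\<close>

lemma alt4_base:
  "alt4 (Node Leaf (Node right2 Leaf), Ri (Le Op)) (Node one left2, Ri Op) (Node (Node Leaf right2) Leaf, Op)
     (Node (Node one one) Leaf, Le Op)"
  by (rule alt4I[where p = True and q = False and r = False and s = True])
    (simp_all add: oriented_ends_def row_def col_def adj_Cons_iff)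

text \<open>
  Edges that no hypertree of the recursion may remove.  They are reserved for the joins made one
  level higher, whose removed edges are opening edges of the root or lifts of forbidden edges.
\<close>

fun forbidden :: "tree \<Rightarrow> addr \<Rightarrow> bool" where
  "forbidden Leaf a = True"
| "forbidden (Node u v) Cl = True"
| "forbidden (Node u v) Op = (u = Leaf \<or> (u = one \<and> v = Leaf))"
| "forbidden (Node u v) (Le a) = (a = Cl \<and> u = one)"
| "forbidden (Node u v) (Ri a) = (a = Cl \<and> u \<noteq> right2)"

text \<open>The joins remove root edges \<open>Op\<close> or lifts of forbidden edges, never lifted
  edges in this sense. In \<open>forbidden\<close>, the two cases of \<open>Op\<close> reserve
  \<open>Le Op\<close> for \<open>alt3_consecutive\<close> and for the tree \<open>left2\<close>;
  \<open>Le Cl\<close> below \<open>one\<close> serves \<open>alt3_halves\<close>,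
  \<open>alt4_parity\<close> and \<open>alt3_rest\<close>; \<open>Ri Cl\<close> serves
  \<open>alt3_consecutive\<close> and \<open>alt3_rest\<close>. The exception \<open>right2\<close>
  is there because \<open>alt4_parity\<close> itself removes such an edge.\<close>

fun lifted :: "tree \<Rightarrow> addr \<Rightarrow> bool" where
  "lifted (Node u v) (Le a) = (\<not> forbidden u a)"
| "lifted (Node u v) (Ri a) = (\<not> forbidden v a)"
| "lifted _ _ = False"

lemma forbidden_Cl [simp]: "forbidden t Cl"
  by (cases t) auto

lemma lifted_not_forbidden: "lifted t a \<Longrightarrow> \<not> forbidden t a"
  by (cases t; cases a) auto

definition good_span :: "nat \<Rightarrow> (tree \<times> addr) set set" where
  "good_span k = {R. span (trees k) R \<and> (\<forall>(t, a)\<in>R. \<not> forbidden t a)}"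

text \<open>A component whose inner hypertree uses lifted edges only, so that the edges reserved for
  joins are still present in it.\<close>

definition part :: "tree set \<Rightarrow> bool" where
  "part W \<longleftrightarrow> (\<exists>R. span W R \<and> (\<forall>(t, a)\<in>R. lifted t a))"

lemma part_single: "part {t}"
  unfolding part_def using span_single by blast

lemma part_row: "good_span j \<noteq> {} \<Longrightarrow> part (Node u ` trees j)"
proof -
  assume "good_span j \<noteq> {}"
  then obtain R where R: "span (trees j) R" "\<forall>(t, a)\<in>R. \<not> forbidden t a"
    by (auto simp: good_span_def)
  then show ?thesis unfolding part_def
    by (intro exI[of _ "lift_row u ` R"]) (auto simp: lift_row_def dest: span_lift_row)
qed

lemma part_col: "good_span i \<noteq> {} \<Longrightarrow> part ((\<lambda>u. Node u v) ` trees i)"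
proof -
  assume "good_span i \<noteq> {}"
  then obtain R where R: "span (trees i) R" "\<forall>(t, a)\<in>R. \<not> forbidden t a"
    by (auto simp: good_span_def)
  then show ?thesis unfolding part_def
    by (intro exI[of _ "lift_col v ` R"]) (auto simp: lift_col_def dest: span_lift_col)
qed

text \<open>
  A box is a grid: all its rows are connected by copies of one hypertree, and a single column
  connects the rows.
\<close>

definition box :: "nat \<Rightarrow> nat \<Rightarrow> tree set" where
  "box i j = {Node u v | u v. size u = i \<and> size v = j}"

text \<open>A standard witness of each size. It is never \<open>right2\<close>, as the joins demand
  of \<open>u\<close>, and at size 2 it is \<open>left2\<close>, the right subtree kept in a
  block.\<close>

fun chain :: "nat \<Rightarrow> tree" where
  "chain 0 = Leaf"
| "chain (Suc n) = Node (chain n) Leaf"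

lemma size_chain [simp]: "size (chain n) = n"
  by (induction n) auto

lemma chain_neq_right2 [simp]: "chain n \<noteq> right2"
  by (cases n) auto

lemma part_box:
  assumes "good_span i \<noteq> {}" "good_span j \<noteq> {}"
  shows "part (box i j)"
proof -
  obtain S where S: "span (trees i) S" "\<forall>(t, a)\<in>S. \<not> forbidden t a"
    using assms(1) by (auto simp: good_span_def)
  obtain R where R: "span (trees j) R" "\<forall>(t, a)\<in>R. \<not> forbidden t a"
    using assms(2) by (auto simp: good_span_def)
  \<comment> \<open>The trees of the column with right subtree \<open>?v\<close> represent the rows
    in \<open>span_compose\<close>. Edges removed along the column start with \<open>Le\<close>,
    those along rows with \<open>Ri\<close>.\<close>
  let ?v = "chain j" and ?left = "\<lambda>t. case t of Node u v \<Rightarrow> u | Leaf \<Rightarrow> Leaf"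
  let ?W = "\<lambda>t. Node (?left t) ` trees j" and ?R = "\<lambda>t. lift_row (?left t) ` R"
  let ?U = "(\<lambda>u. Node u ?v) ` trees i" and ?S = "lift_col ?v ` S"
  have "span (\<Union>t\<in>?U. ?W t) (?S \<union> (\<Union>t\<in>?U. ?R t))"
  proof (rule span_compose)
    show "span ?U ?S" by (rule span_lift_col[OF S(1)])
    show "span (?W t) (?R t) \<and> t \<in> ?W t" if "t \<in> ?U" for t
      using that span_lift_row[OF R(1)] by (auto simp: trees_def)
    show "(t, a) \<notin> ?R t" if "(t, a) \<in> ?S" for t a
      using that by (auto simp: lift_col_def lift_row_def)
  qed auto
  moreover have "(\<Union>t\<in>?U. ?W t) = box i j"
    by (auto simp: box_def trees_def)
  moreover have "\<forall>(t, a)\<in>?S \<union> (\<Union>t\<in>?U. ?R t). lifted t a"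
    using S(2) R(2) by (auto simp: lift_col_def lift_row_def)
  ultimately show ?thesis unfolding part_def by auto
qed

section \<open>Hypertrees for sizes up to 4\<close>

lemma trees_0: "trees 0 = {Leaf}"
proof -
  have "size t = 0 \<longleftrightarrow> t = Leaf" for t :: tree by (cases t) auto
  then show ?thesis by (auto simp: trees_def)
qed

lemma trees_Suc: "trees (Suc n) = (\<Union>i\<le>n. case_prod Node ` (trees i \<times> trees (n - i)))"
proof -
  have "t \<in> trees (Suc n) \<longleftrightarrow> (\<exists>u v. t = Node u v \<and> size u + size v = n)" for t
    by (cases t) (auto simp: trees_def)
  then show ?thesis by (fastforce simp: trees_def)
qed

lemma trees_1: "trees 1 = {one}"
  unfolding One_nat_def trees_Suc by (simp add: trees_0)

lemma trees_2: "trees 2 = {left2, right2}"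
proof -
  have "{..Suc 0} = {0, Suc 0}" by auto
  then have "trees (Suc (Suc 0)) = {left2, right2}"
    unfolding trees_Suc[of "Suc 0"] by (simp add: trees_0 trees_1[unfolded One_nat_def] insert_commute)
  then show ?thesis by (simp add: numeral_2_eq_2)
qed

lemma trees_3: "trees 3 = {Node left2 Leaf, Node right2 Leaf, Node one one, Node Leaf left2, Node Leaf right2}"
proof -
  have "{..2} = {0, 1, 2 :: nat}" by auto
  then have "trees (Suc 2) = {Node left2 Leaf, Node right2 Leaf, Node one one, Node Leaf left2, Node Leaf right2}"
    unfolding trees_Suc[of 2]
    by (simp add: trees_0 trees_1 trees_1[unfolded One_nat_def] trees_2 insert_commute)
  then show ?thesis by simp
qed

lemma trees_4: "trees 4 = Node Leaf ` trees 3 \<union> {Node one left2, Node one right2, Node left2 one, Node right2 one,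
   Node (Node left2 Leaf) Leaf, Node (Node right2 Leaf) Leaf, Node (Node one one) Leaf, Node (Node Leaf left2) Leaf, Node (Node Leaf right2) Leaf}"
proof -
  have "{..3} = {0, 1, 2, 3 :: nat}" by auto
  then have "trees (Suc 3) = Node Leaf ` trees 3 \<union> {Node one left2, Node one right2, Node left2 one, Node right2 one,
   Node (Node left2 Leaf) Leaf, Node (Node right2 Leaf) Leaf, Node (Node one one) Leaf, Node (Node Leaf left2) Leaf, Node (Node Leaf right2) Leaf}"
    unfolding trees_Suc[of 3]
    by (simp add: trees_0 trees_1 trees_1[unfolded One_nat_def] trees_2 trees_3 insert_commute)
  then show ?thesis by simp
qed

lemma good_span_0: "good_span 0 \<noteq> {}"
  using span_single[of Leaf] by (auto simp: good_span_def trees_0)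

lemma good_span_1: "good_span (Suc 0) \<noteq> {}"
  using span_single[of one] trees_1 by (auto simp: good_span_def)

text \<open>\<open>alt3_halves\<close> with \<open>q = Leaf\<close> and
  \<open>alt3_consecutive\<close> with \<open>u = q = Leaf\<close>; they share the tree
  \<open>Node left2 Leaf\<close> but remove different edges of it.\<close>

definition R3 :: "(tree \<times> addr) set" where
  "R3 = {(Node right2 Leaf, Op), (Node left2 Leaf, Le Op), (Node Leaf left2, Ri (Le Cl)),
         (Node left2 Leaf, Op), (Node one one, Le Op), (Node Leaf right2, Ri (Ri Cl))}"

lemma span_R3: "span (trees 3) R3"
proof -
  have 1: "span ({Node right2 Leaf} \<union> {Node left2 Leaf} \<union> {Node Leaf left2})
      ({} \<union> {} \<union> {} \<union> {(Node right2 Leaf, Op), (Node left2 Leaf, Le Op), (Node Leaf left2, Ri (Le Cl))})"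
    by (rule span_join3[OF span_single span_single span_single _ _ _ _ _ _ _ _ _ alt3_halves]) simp_all
  have "span (({Node right2 Leaf} \<union> {Node left2 Leaf} \<union> {Node Leaf left2}) \<union> {Node one one} \<union> {Node Leaf right2})
      (({} \<union> {} \<union> {} \<union> {(Node right2 Leaf, Op), (Node left2 Leaf, Le Op), (Node Leaf left2, Ri (Le Cl))}) \<union> {} \<union> {} \<union>
       {(Node left2 Leaf, Op), (Node one one, Le Op), (Node Leaf right2, Ri (Ri Cl))})"
    by (rule span_join3[OF 1 span_single span_single _ _ _ _ _ _ _ _ _ alt3_consecutive]) simp_all
  moreover have "({Node right2 Leaf} \<union> {Node left2 Leaf} \<union> {Node Leaf left2}) \<union> {Node one one} \<union> {Node Leaf right2} = trees 3"
    unfolding trees_3 by (simp add: insert_commute)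
  moreover have "({} \<union> {} \<union> {} \<union> {(Node right2 Leaf, Op), (Node left2 Leaf, Le Op), (Node Leaf left2, Ri (Le Cl))}) \<union> {} \<union> {} \<union>
       {(Node left2 Leaf, Op), (Node one one, Le Op), (Node Leaf right2, Ri (Ri Cl))} = R3"
    unfolding R3_def by (simp add: insert_commute)
  ultimately show ?thesis by (simp only:)
qed

lemma good_span_3: "good_span 3 \<noteq> {}"
  using span_R3 by (auto simp: good_span_def R3_def)

text \<open>The trees with empty left subtree form one component by the lift of \<open>R3\<close>,
  the other nine are single. One join of four and three joins of three reduce these ten components
  to one.\<close>

lemma good_span_4: "good_span 4 \<noteq> {}"
proof -
  let ?W0 = "Node Leaf ` trees 3" and ?R0 = "lift_row Leaf ` R3"
  let ?W1 = "?W0 \<union> {Node one left2} \<union> {Node (Node Leaf right2) Leaf} \<union> {Node (Node one one) Leaf}"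
  let ?R1 = "?R0 \<union> {} \<union> {} \<union> {} \<union> {(Node Leaf (Node right2 Leaf), Ri (Le Op)), (Node one left2, Ri Op),
     (Node (Node Leaf right2) Leaf, Op), (Node (Node one one) Leaf, Le Op)}"
  let ?W2 = "{Node (Node left2 Leaf) Leaf} \<union> {Node right2 one} \<union> ?W1"
  let ?R2 = "{} \<union> {} \<union> ?R1 \<union> {(Node (Node left2 Leaf) Leaf, Op), (Node right2 one, Le Op),
     (Node Leaf (Node one one), Ri (Ri Cl))}"
  let ?W3 = "{Node left2 one} \<union> {Node one right2} \<union> ?W2"
  let ?R3 = "{} \<union> {} \<union> ?R2 \<union> {(Node left2 one, Op), (Node one right2, Le Op),
     (Node Leaf (Node Leaf right2), Ri (Ri Cl))}"
  let ?W4 = "{Node (Node right2 Leaf) Leaf} \<union> ?W3 \<union> {Node (Node Leaf left2) Leaf}"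
  let ?R4 = "{} \<union> ?R3 \<union> {} \<union> {(Node (Node right2 Leaf) Leaf, Le Op), (Node (Node left2 Leaf) Leaf, Le (Le Op)),
     (Node (Node Leaf left2) Leaf, Le (Ri (Le Cl)))}"
  have "span ?W1 ?R1"
    by (rule span_join4[OF span_lift_row[OF span_R3] span_single span_single span_single
          _ _ _ _ _ _ _ _ _ _ _ _ _ _ alt4_base]) (auto simp: trees_3 R3_def lift_row_def)
  then have "span ?W2 ?R2"
    by (rule span_join3[OF span_single span_single _ _ _ _ _ _ _ _ _ _ alt3_consecutive])
      (auto simp: trees_3 R3_def lift_row_def)
  then have "span ?W3 ?R3"
    by (rule span_join3[OF span_single span_single _ _ _ _ _ _ _ _ _ _ alt3_consecutive])
      (auto simp: trees_3 R3_def lift_row_def)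
  then have sp: "span ?W4 ?R4"
    by (rule span_join3[OF span_single _ span_single _ _ _ _ _ _ _ _ _
          alt3_lift_col[OF alt3_halves, of Leaf Leaf, unfolded lift_col_def, simplified]])
      (auto simp: trees_3 R3_def lift_row_def)
  have eq: "?W4 = trees 4" unfolding trees_4 by (simp add: insert_commute)
  have nf: "\<forall>(t, a)\<in>?R4. \<not> forbidden t a"
    by (auto simp: R3_def lift_row_def)
  have "?R4 \<in> good_span 4"
    unfolding good_span_def mem_Collect_eq using sp[unfolded eq] nf by (rule conjI)
  then show ?thesis by blast
qed

section \<open>The recursion\<close>

text \<open>
  The hypertree \<open>R\<close> on the words \<open>1 0 v\<close> stays exchangeable, while \<open>B\<close> is fixed.
\<close>

definition partial_span :: "(tree \<times> addr) set set \<Rightarrow> nat \<Rightarrow> tree set \<Rightarrow> (tree \<times> addr) set \<Rightarrow> bool" where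
  "partial_span F n W B \<longleftrightarrow> (\<forall>R\<in>F. span W (lift_row Leaf ` R \<union> B)) \<and> fst ` B \<subseteq> W \<and>
     (\<forall>(t, a)\<in>B. \<not> forbidden t a) \<and>
     (\<forall>v a. (Node Leaf v, Ri a) \<in> B \<longrightarrow> forbidden v a) \<and>
     (\<forall>u v. (Node Leaf (Node u v), Ri (Ri Cl)) \<in> B \<longrightarrow> size u < n)"

section \<open>Enlarging a partial hypertree by one join\<close>

lemma partial_span_start: "partial_span (good_span j) 0 (Node Leaf ` trees j) {}"
  by (auto simp: partial_span_def good_span_def span_lift_row)

lemma not_in_lift_row:
  assumes "R \<in> good_span j" "\<And>v a. x = (Node Leaf v, Ri a) \<Longrightarrow> forbidden v a"
  shows "x \<notin> lift_row Leaf ` R"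
  using assms by (auto simp: lift_row_def good_span_def)

text \<open>Only \<open>x\<close> lies in the component with the exchangeable row, so it must avoid
  all lifts from the family at once; being forbidden below \<open>Node Leaf\<close> ensures this.
  \<open>y\<close> and \<open>z\<close> are available because they are not lifted.\<close>

lemma partial_span_join3:
  assumes m: "partial_span (good_span j) n W B"
    and p: "part W1" "part W2"
    and d: "W \<inter> W1 = {}" "W \<inter> W2 = {}" "W1 \<inter> W2 = {}"
    and nLf: "\<And>v. Node Leaf v \<notin> W1 \<union> W2"
    and alt: "alt3 x y z" and fs: "fst x \<in> W" "fst y \<in> W1" "fst z \<in> W2"
    and xB: "x \<notin> B" and xf: "\<And>v a. x = (Node Leaf v, Ri a) \<Longrightarrow> forbidden v a"
    and nl: "\<not> lifted (fst y) (snd y)" "\<not> lifted (fst z) (snd z)"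
    and nf: "\<not> forbidden (fst x) (snd x)" "\<not> forbidden (fst y) (snd y)" "\<not> forbidden (fst z) (snd z)"
    and xn: "\<And>u v. x = (Node Leaf (Node u v), Ri (Ri Cl)) \<Longrightarrow> size u < n'" and nn': "n \<le> n'"
  shows "\<exists>B'. partial_span (good_span j) n' (W \<union> W1 \<union> W2) B' \<and>
    (\<forall>e\<in>B'. e \<in> B \<union> {x, y, z} \<or> lifted (fst e) (snd e))"
proof -
  obtain X1 X2 where X: "span W1 X1" "span W2 X2"
    and l: "\<And>e. e \<in> X1 \<union> X2 \<Longrightarrow> lifted (fst e) (snd e)"
    using p unfolding part_def by fastforce
  have fX: "fst e \<in> W1 \<union> W2" if "e \<in> X1 \<union> X2" for e using X that span_fst by blast
  define B' where "B' = B \<union> X1 \<union> X2 \<union> {x, y, z}"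
  have B'_cases: "e \<in> B \<or> e = x \<or> (fst e \<in> W1 \<union> W2 \<and> \<not> forbidden (fst e) (snd e))"
    if "e \<in> B'" for e
    using that fX l lifted_not_forbidden fs nf unfolding B'_def by blast
  have "span (W \<union> W1 \<union> W2) (lift_row Leaf ` R \<union> B')" if R: "R \<in> good_span j" for R
  proof -
    have s: "span W (lift_row Leaf ` R \<union> B)" using m R by (auto simp: partial_span_def)
    have "x \<notin> lift_row Leaf ` R \<union> B" "y \<notin> X1" "z \<notin> X2"
      using not_in_lift_row[OF R xf] xB l nl by auto
    from span_join3[OF s X d fs this alt]
    have "span (W \<union> W1 \<union> W2) (lift_row Leaf ` R \<union> B \<union> X1 \<union> X2 \<union> {x, y, z})" .
    moreover have "lift_row Leaf ` R \<union> B \<union> X1 \<union> X2 \<union> {x, y, z} = lift_row Leaf ` R \<union> B'"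
      unfolding B'_def by blast
    ultimately show ?thesis by (simp only:)
  qed
  moreover have "fst e \<in> W \<union> W1 \<union> W2" if "e \<in> B'" for e
    using B'_cases[OF that] m fs by (auto simp: partial_span_def)
  moreover have "\<not> forbidden (fst e) (snd e)" if "e \<in> B'" for e
    using B'_cases[OF that] m nf by (auto simp: partial_span_def)
  moreover have "forbidden v a" if "(Node Leaf v, Ri a) \<in> B'" for v a
    using B'_cases[OF that] m xf nLf by (auto simp: partial_span_def)
  moreover have "size u < n'" if "(Node Leaf (Node u v), Ri (Ri Cl)) \<in> B'" for u v
    using B'_cases[OF that] m xn nLf nn' unfolding partial_span_def by fastforce
  ultimately have "partial_span (good_span j) n' (W \<union> W1 \<union> W2) B'"
    unfolding partial_span_def by fastforce
  moreover have "\<forall>e\<in>B'. e \<in> B \<union> {x, y, z} \<or> lifted (fst e) (snd e)"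
    unfolding B'_def using l by blast
  ultimately show ?thesis by blast
qed

lemma partial_span_join4:
  assumes m: "partial_span (good_span j) n W B"
    and p: "part W1" "part W2" "part W3"
    and d: "W \<inter> W1 = {}" "W \<inter> W2 = {}" "W \<inter> W3 = {}" "W1 \<inter> W2 = {}" "W1 \<inter> W3 = {}" "W2 \<inter> W3 = {}"
    and nLf: "\<And>v. Node Leaf v \<notin> W1 \<union> W2 \<union> W3"
    and alt: "alt4 x y z w" and fs: "fst x \<in> W" "fst y \<in> W1" "fst z \<in> W2" "fst w \<in> W3"
    and xB: "x \<notin> B" and xf: "\<And>v a. x = (Node Leaf v, Ri a) \<Longrightarrow> forbidden v a"
    and nl: "\<not> lifted (fst y) (snd y)" "\<not> lifted (fst z) (snd z)" "\<not> lifted (fst w) (snd w)"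
    and nf: "\<not> forbidden (fst x) (snd x)" "\<not> forbidden (fst y) (snd y)" "\<not> forbidden (fst z) (snd z)"
      "\<not> forbidden (fst w) (snd w)"
    and xn: "\<And>u v. x = (Node Leaf (Node u v), Ri (Ri Cl)) \<Longrightarrow> size u < n'" and nn': "n \<le> n'"
  shows "\<exists>B'. partial_span (good_span j) n' (W \<union> W1 \<union> W2 \<union> W3) B' \<and>
    (\<forall>e\<in>B'. e \<in> B \<union> {x, y, z, w} \<or> lifted (fst e) (snd e))"
proof -
  obtain X1 X2 X3 where X: "span W1 X1" "span W2 X2" "span W3 X3"
    and l: "\<And>e. e \<in> X1 \<union> X2 \<union> X3 \<Longrightarrow> lifted (fst e) (snd e)"
    using p unfolding part_def by fastforce
  have fX: "fst e \<in> W1 \<union> W2 \<union> W3" if "e \<in> X1 \<union> X2 \<union> X3" for e using X that span_fst by blast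
  define B' where "B' = B \<union> X1 \<union> X2 \<union> X3 \<union> {x, y, z, w}"
  have B'_cases: "e \<in> B \<or> e = x \<or> (fst e \<in> W1 \<union> W2 \<union> W3 \<and> \<not> forbidden (fst e) (snd e))"
    if "e \<in> B'" for e
    using that fX l lifted_not_forbidden fs nf unfolding B'_def by blast
  have "span (W \<union> W1 \<union> W2 \<union> W3) (lift_row Leaf ` R \<union> B')" if R: "R \<in> good_span j" for R
  proof -
    have s: "span W (lift_row Leaf ` R \<union> B)" using m R by (auto simp: partial_span_def)
    have "x \<notin> lift_row Leaf ` R \<union> B" "y \<notin> X1" "z \<notin> X2" "w \<notin> X3"
      using not_in_lift_row[OF R xf] xB l nl by auto
    from span_join4[OF s X d fs this alt]
    have "span (W \<union> W1 \<union> W2 \<union> W3) (lift_row Leaf ` R \<union> B \<union> X1 \<union> X2 \<union> X3 \<union> {x, y, z, w})" .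
    moreover have "lift_row Leaf ` R \<union> B \<union> X1 \<union> X2 \<union> X3 \<union> {x, y, z, w} = lift_row Leaf ` R \<union> B'"
      unfolding B'_def by blast
    ultimately show ?thesis by (simp only:)
  qed
  moreover have "fst e \<in> W \<union> W1 \<union> W2 \<union> W3" if "e \<in> B'" for e
    using B'_cases[OF that] m fs by (auto simp: partial_span_def)
  moreover have "\<not> forbidden (fst e) (snd e)" if "e \<in> B'" for e
    using B'_cases[OF that] m nf by (auto simp: partial_span_def)
  moreover have "forbidden v a" if "(Node Leaf v, Ri a) \<in> B'" for v a
    using B'_cases[OF that] m xf nLf by (auto simp: partial_span_def)
  moreover have "size u < n'" if "(Node Leaf (Node u v), Ri (Ri Cl)) \<in> B'" for u v
    using B'_cases[OF that] m xn nLf nn' unfolding partial_span_def by fastforce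
  ultimately have "partial_span (good_span j) n' (W \<union> W1 \<union> W2 \<union> W3) B'"
    unfolding partial_span_def by fastforce
  moreover have "\<forall>e\<in>B'. e \<in> B \<union> {x, y, z, w} \<or> lifted (fst e) (snd e)"
    unfolding B'_def using l by blast
  ultimately show ?thesis by blast
qed

lemma partial_span_halves:
  assumes "partial_span (good_span j) n W B" "part W1" "part W2"
    and "W \<inter> W1 = {}" "W \<inter> W2 = {}" "W1 \<inter> W2 = {}" "\<And>v. Node Leaf v \<notin> W1 \<union> W2"
    and "Node Leaf (Node one q) \<in> W" "Node right2 q \<in> W1" "Node left2 q \<in> W2"
    and "(Node Leaf (Node one q), Ri (Le Cl)) \<notin> B"
  shows "\<exists>B'. partial_span (good_span j) n (W \<union> W1 \<union> W2) B' \<and>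
    (\<forall>e\<in>B'. e \<in> B \<union> {(Node Leaf (Node one q), Ri (Le Cl)), (Node right2 q, Op), (Node left2 q, Le Op)} \<or>
       lifted (fst e) (snd e))"
  by (rule partial_span_join3[OF assms(1-7) alt3_rotate[OF alt3_rotate[OF alt3_halves]]]) (use assms(8-11) in auto)

lemma partial_span_parity:
  assumes "partial_span (good_span j) n W B" "part W1" "part W2" "part W3"
    and "W \<inter> W1 = {}" "W \<inter> W2 = {}" "W \<inter> W3 = {}" "W1 \<inter> W2 = {}" "W1 \<inter> W3 = {}" "W2 \<inter> W3 = {}"
    and "\<And>v. Node Leaf v \<notin> W1 \<union> W2 \<union> W3"
    and "Node Leaf (Node one (Node Leaf q)) \<in> W" "Node left2 (Node Leaf q) \<in> W1" "Node (Node Leaf left2) q \<in> W2"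
      "Node right2 (Node Leaf q) \<in> W3"
    and "(Node Leaf (Node one (Node Leaf q)), Ri (Le Cl)) \<notin> B"
  shows "\<exists>B'. partial_span (good_span j) n (W \<union> W1 \<union> W2 \<union> W3) B' \<and>
    (\<forall>e\<in>B'. e \<in> B \<union> {(Node Leaf (Node one (Node Leaf q)), Ri (Le Cl)), (Node left2 (Node Leaf q), Le Op),
       (Node (Node Leaf left2) q, Op), (Node right2 (Node Leaf q), Ri Cl)} \<or> lifted (fst e) (snd e))"
  by (rule partial_span_join4[OF assms(1-11) alt4_rotate[OF alt4_rotate[OF alt4_rotate[OF alt4_parity]]]])
    (use assms(12-16) in auto)

text \<open>The bound \<open>n\<close> makes the edge of \<open>W\<close> new: earlier edges
  \<open>Ri (Ri Cl)\<close> in the row of \<open>Leaf\<close> belong to smaller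
  \<open>u\<close>.\<close>

lemma partial_span_consecutive:
  assumes "partial_span (good_span j) n W B" "part W1" "part W2"
    and "W \<inter> W1 = {}" "W \<inter> W2 = {}" "W1 \<inter> W2 = {}" "\<And>v. Node Leaf v \<notin> W1 \<union> W2"
    and "Node Leaf (Node u (Node Leaf q)) \<in> W" "Node (Node (Node u Leaf) Leaf) q \<in> W1" "Node (Node Leaf u) (Node Leaf q) \<in> W2"
    and "u \<noteq> right2" "n \<le> size u" "size u < n'"
  shows "\<exists>B'. partial_span (good_span j) n' (W \<union> W1 \<union> W2) B' \<and>
    (\<forall>e\<in>B'. e \<in> B \<union> {(Node Leaf (Node u (Node Leaf q)), Ri (Ri Cl)), (Node (Node (Node u Leaf) Leaf) q, Op),
       (Node (Node Leaf u) (Node Leaf q), Le Op)} \<or> lifted (fst e) (snd e))"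
proof -
  have "(Node Leaf (Node u (Node Leaf q)), Ri (Ri Cl)) \<notin> B"
    using assms(1,12) by (force simp: partial_span_def)
  then show ?thesis
    by (intro partial_span_join3[OF assms(1-7) alt3_rotate[OF alt3_rotate[OF alt3_consecutive]]]) (use assms(8-13) in auto)
qed

lemma partial_span_rest:
  assumes "partial_span (good_span j) n W B" "part W1" "part W2"
    and "W \<inter> W1 = {}" "W \<inter> W2 = {}" "W1 \<inter> W2 = {}" "\<And>v. Node Leaf v \<notin> W1 \<union> W2"
    and "Node (Node one u) (Node Leaf q) \<in> W" "Node one (Node u (Node Leaf q)) \<in> W1"
      "Node (Node Leaf (Node (Node u Leaf) Leaf)) q \<in> W2"
    and "u \<noteq> right2" "(Node (Node one u) (Node Leaf q), Le (Le Cl)) \<notin> B"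
  shows "\<exists>B'. partial_span (good_span j) n (W \<union> W1 \<union> W2) B'"
  using partial_span_join3[OF assms(1-7) alt3_rotate[OF alt3_rest[of u q]], of n] assms(8-12) by auto

lemma size_0_iff: "size t = 0 \<longleftrightarrow> t = Leaf" for t :: tree
  by (cases t) auto

lemma size_1_iff: "size t = Suc 0 \<longleftrightarrow> t = one"
  using trees_1 by (auto simp: trees_def)

lemma size_2_iff: "size t = 2 \<longleftrightarrow> t = left2 \<or> t = right2"
  using trees_2 by (auto simp: trees_def)

lemma partial_span_good:
  assumes "partial_span (good_span j) n (trees k) B" "R \<in> good_span j"
  shows "lift_row Leaf ` R \<union> B \<in> good_span k"
  using assms by (auto simp: partial_span_def good_span_def lift_row_def)

lemma partial_span_mono: "partial_span F n W B \<Longrightarrow> n \<le> n' \<Longrightarrow> partial_span F n' W B"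
  unfolding partial_span_def by fastforce

lemma Node_in_box [simp]: "Node u v \<in> box i j \<longleftrightarrow> size u = i \<and> size v = j"
  by (auto simp: box_def)

lemma Node_in_row [simp]: "Node u v \<in> Node w ` trees j \<longleftrightarrow> u = w \<and> size v = j"
  by (auto simp: trees_def)

lemma Node_in_col [simp]: "Node u v \<in> (\<lambda>u. Node u w) ` trees i \<longleftrightarrow> size u = i \<and> v = w"
  by (auto simp: trees_def)

lemma Leaf_notin [simp]: "Leaf \<notin> box i j" "Leaf \<notin> Node w ` trees j" "Leaf \<notin> (\<lambda>u. Node u w) ` trees i"
  by (auto simp: box_def)

lemma disjoint_if_Node:
  assumes "Leaf \<notin> A" "\<And>u v. Node u v \<in> A \<Longrightarrow> Node u v \<in> B \<Longrightarrow> False"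
  shows "A \<inter> B = {}"
proof -
  have False if "t \<in> A" "t \<in> B" for t using that assms by (cases t) auto
  then show ?thesis by blast
qed

text \<open>Reserves the edge that \<open>partial_span_rest\<close> removes from the component
  already built.\<close>

definition rest_free :: "(tree \<times> addr) set \<Rightarrow> bool" where
  "rest_free B \<longleftrightarrow> (\<forall>u v. (Node (Node one u) v, Le (Le Cl)) \<notin> B)"

text \<open>Here \<open>k - 3 = 2\<close>, so the words with two subtrees of size 2 are four single
  components, eight components in all. Joins of three, four and three connect them.\<close>

lemma good_span_5: "good_span 5 \<noteq> {}"
proof -
  let ?W0 = "Node Leaf ` trees 4"
  let ?W1 = "?W0 \<union> {Node right2 left2} \<union> {Node left2 left2}"
  let ?W2 = "?W1 \<union> {Node left2 right2} \<union> box 3 1 \<union> {Node right2 right2}"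
  let ?W3 = "?W2 \<union> Node one ` trees 3 \<union> (\<lambda>u. Node u Leaf) ` trees 4"
  have "\<exists>B. partial_span (good_span 4) 0 ?W1 B \<and> (\<forall>e\<in>B. e \<in> {} \<union> {(Node Leaf (Node one left2), Ri (Le Cl)),
      (Node right2 left2, Op), (Node left2 left2, Le Op)} \<or> lifted (fst e) (snd e))"
    by (rule partial_span_halves[OF partial_span_start part_single part_single]) auto
  then obtain B1 where B1: "partial_span (good_span 4) 0 ?W1 B1"
    "\<And>e. e \<in> B1 \<Longrightarrow> e \<in> {(Node Leaf (Node one left2), Ri (Le Cl)),
      (Node right2 left2, Op), (Node left2 left2, Le Op)} \<or> lifted (fst e) (snd e)" by auto
  have "(Node Leaf (Node one right2), Ri (Le Cl)) \<notin> B1" using B1(2) by fastforce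
  then have "\<exists>B. partial_span (good_span 4) 0 ?W2 B \<and> (\<forall>e\<in>B. e \<in> B1 \<union> {(Node Leaf (Node one right2), Ri (Le Cl)),
      (Node left2 right2, Le Op), (Node (Node Leaf left2) one, Op), (Node right2 right2, Ri Cl)}
      \<or> lifted (fst e) (snd e))"
    using good_span_3 good_span_1
    by (intro partial_span_parity[OF B1(1) part_single part_box part_single]) auto
  then obtain B2 where B2: "partial_span (good_span 4) 0 ?W2 B2"
    "\<And>e. e \<in> B2 \<Longrightarrow> e \<in> B1 \<union> {(Node Leaf (Node one right2), Ri (Le Cl)),
      (Node left2 right2, Le Op), (Node (Node Leaf left2) one, Op), (Node right2 right2, Ri Cl)}
      \<or> lifted (fst e) (snd e)" by auto
  \<comment> \<open>The edge \<open>Le Cl\<close> of \<open>Node one one\<close> is forbidden, so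
    its lift is not among the lifted edges.\<close>
  have "(Node (Node one one) one, Le (Le Cl)) \<notin> B2" using B1(2) B2(2) by fastforce
  then have "\<exists>B. partial_span (good_span 4) 0 ?W3 B"
    using part_row[OF good_span_3] part_col[OF good_span_4]
    by (intro partial_span_rest[OF B2(1), where u = one and q = Leaf]) (auto simp: trees_def box_def)
  moreover have "?W3 = trees 5"
  proof (rule set_eqI)
    fix t
    show "t \<in> ?W3 \<longleftrightarrow> t \<in> trees 5"
    proof (cases t)
      case (Node u v)
      consider "size u = 0" | "size u = 1" | "size u = 2" | "size u = 3" | "size u = 4" | "size u \<ge> 5"
        by linarith
      then show ?thesis
        by cases (auto simp: Node trees_def size_0_iff size_1_iff size_2_iff)
    qed (auto simp: trees_def)
  qed
  ultimately show ?thesis using partial_span_good good_span_4 by (metis ex_in_conv)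
qed

text \<open>
  The two trees of size 2 cannot be joined inside a box.  Hence the words whose left subtree has
  size 2 form two components, and so do those whose left subtree has size \<open>k - 3\<close>; of the
  latter only the component with right subtree \<open>left2\<close> is a block, the other one is attached by
  \<open>partial_span_rest\<close>.
\<close>

definition block :: "nat \<Rightarrow> nat \<Rightarrow> tree set" where
  "block k m = (if m = k - 3 then (\<lambda>u. Node u left2) ` trees (k - 3) else box m (k - 1 - m))"

text \<open>Left subtrees of size 1 are left out; \<open>alt3_rest\<close> attaches them after all
  blocks.\<close>

definition blocks_below :: "nat \<Rightarrow> nat \<Rightarrow> tree set" where
  "blocks_below k n = Node Leaf ` trees (k - 1) \<union> Node right2 ` trees (k - 3) \<union> Node left2 ` trees (k - 3) \<union>
     (\<Union>m\<in>{3..<n}. block k m)"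

lemma Node_in_block: "Node u v \<in> block k m \<longleftrightarrow>
    size u = m \<and> (if m = k - 3 then v = left2 else size v = k - 1 - m)"
  by (auto simp: block_def)

lemma Leaf_notin_block: "Leaf \<notin> block k m"
  by (auto simp: block_def)

lemma Node_in_blocks_below: "Node u v \<in> blocks_below k n \<longleftrightarrow>
    (u = Leaf \<and> size v = k - 1) \<or> ((u = left2 \<or> u = right2) \<and> size v = k - 3) \<or>
    (3 \<le> size u \<and> size u < n \<and> (if size u = k - 3 then v = left2 else size v = k - 1 - size u))"
  by (auto simp: blocks_below_def Node_in_block)

lemma Leaf_notin_blocks_below: "Leaf \<notin> blocks_below k n"
  by (auto simp: blocks_below_def Leaf_notin_block)

lemma part_block:
  assumes "\<And>i. i < k \<Longrightarrow> i \<noteq> 2 \<Longrightarrow> good_span i \<noteq> {}" "6 \<le> k" "3 \<le> m" "m < k"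
  shows "part (block k m)"
  using assms by (auto simp: block_def intro!: part_box part_col)

lemma blocks_below_Suc: "3 \<le> n \<Longrightarrow> blocks_below k (Suc n) = blocks_below k n \<union> block k n"
  by (auto simp: blocks_below_def less_Suc_eq)

lemma chain_2: "chain 2 = left2"
  by (simp add: numeral_2_eq_2)

text \<open>Blocks are attached in pairs. For even \<open>k\<close> the block of size 3 is absorbed
  by the join of four at the start, so that the remaining blocks up to \<open>k - 3\<close> pair up
  in both cases.\<close>

lemma partial_span_blocks:
  assumes ne: "\<And>i. i < k \<Longrightarrow> i \<noteq> 2 \<Longrightarrow> good_span i \<noteq> {}" and k: "6 \<le> k"
    and n: "n = (if odd k then 3 else 4) + 2 * i" "n \<le> k - 2"
  shows "\<exists>B. partial_span (good_span (k - 1)) (n - 1) (blocks_below k n) B \<and> rest_free B"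
  using n
proof (induction i arbitrary: n)
  case 0
  let ?P0 = "Node Leaf ` trees (k - 1)" and ?PR = "Node right2 ` trees (k - 3)" and ?PL = "Node left2 ` trees (k - 3)"
  have "k - 3 \<noteq> 2" "k - 3 < k" using k by arith+
  then have p: "part ?PR" "part ?PL" using ne by (auto intro!: part_row)
  show ?case
  proof (cases "odd k")
    case True
    with 0 have n3: "n = 3" by simp
    let ?q = "chain (k - 3)"
    have "\<exists>B. partial_span (good_span (k - 1)) 0 (?P0 \<union> ?PR \<union> ?PL) B \<and>
       (\<forall>e\<in>B. e \<in> {} \<union> {(Node Leaf (Node one ?q), Ri (Le Cl)), (Node right2 ?q, Op), (Node left2 ?q, Le Op)} \<or>
         lifted (fst e) (snd e))"
      by (rule partial_span_halves[OF partial_span_start p]) (use k in auto)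
    then obtain B where B: "partial_span (good_span (k - 1)) 0 (?P0 \<union> ?PR \<union> ?PL) B"
      "\<And>e. e \<in> B \<Longrightarrow> e \<in> {(Node Leaf (Node one ?q), Ri (Le Cl)), (Node right2 ?q, Op), (Node left2 ?q, Le Op)} \<or>
         lifted (fst e) (snd e)" by auto
    have "rest_free B" unfolding rest_free_def using B(2) by fastforce
    moreover have "blocks_below k n = ?P0 \<union> ?PR \<union> ?PL" by (simp add: blocks_below_def n3)
    ultimately show ?thesis using partial_span_mono[OF B(1), of "n - 1"] by auto
  next
    case False
    with 0 have n4: "n = 4" by simp
    let ?q = "chain (k - 4)"
    have c: "part (block k 3)" using part_block ne k by auto
    have "k = 6 \<or> k \<noteq> 6 \<and> k - 3 \<noteq> 3" using k by auto
    then have mem: "Node (Node Leaf left2) ?q \<in> block k 3"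
      using k by (auto simp: Node_in_block chain_2)
    have "\<exists>B. partial_span (good_span (k - 1)) 0 (?P0 \<union> ?PL \<union> block k 3 \<union> ?PR) B \<and>
       (\<forall>e\<in>B. e \<in> {} \<union> {(Node Leaf (Node one (Node Leaf ?q)), Ri (Le Cl)), (Node left2 (Node Leaf ?q), Le Op),
       (Node (Node Leaf left2) ?q, Op), (Node right2 (Node Leaf ?q), Ri Cl)} \<or> lifted (fst e) (snd e))"
    proof (rule partial_span_parity[OF partial_span_start p(2) c p(1)])
      show "?P0 \<inter> ?PL = {}" "?PL \<inter> ?PR = {}" "?P0 \<inter> ?PR = {}"
        by auto
      show "?P0 \<inter> block k 3 = {}" "?PL \<inter> block k 3 = {}"
        by (rule disjoint_if_Node; auto simp: Node_in_block Leaf_notin_block)+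
      show "block k 3 \<inter> ?PR = {}"
        by (rule disjoint_if_Node) (auto simp: Node_in_block Leaf_notin_block)
      show "Node Leaf v \<notin> ?PL \<union> block k 3 \<union> ?PR" for v
        by (auto simp: Node_in_block)
    qed (use k mem in auto)
    then obtain B where B: "partial_span (good_span (k - 1)) 0 (?P0 \<union> ?PL \<union> block k 3 \<union> ?PR) B"
      "\<And>e. e \<in> B \<Longrightarrow> e \<in> {(Node Leaf (Node one (Node Leaf ?q)), Ri (Le Cl)), (Node left2 (Node Leaf ?q), Le Op),
       (Node (Node Leaf left2) ?q, Op), (Node right2 (Node Leaf ?q), Ri Cl)} \<or> lifted (fst e) (snd e)" by auto
    have "rest_free B" unfolding rest_free_def using B(2) by fastforce
    moreover have "blocks_below k n = ?P0 \<union> ?PL \<union> block k 3 \<union> ?PR"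
    proof -
      have "{3..<4} = {3 :: nat}" by auto
      then show ?thesis by (auto simp: blocks_below_def n4)
    qed
    ultimately show ?thesis using partial_span_mono[OF B(1), of "n - 1"] by auto
  qed
next
  case (Suc i)
  define m where "m = (if odd k then 3 else 4) + 2 * i"
  have nm: "n = m + 2" "3 \<le> m" "m \<le> k - 4" using Suc.prems k by (auto simp: m_def)
  \<comment> \<open>As \<open>m\<close> has the parity of \<open>k\<close>, only the upper block
    \<open>m + 1\<close> of a pair can be the exceptional one of size \<open>k - 3\<close>.\<close>
  have "even (k - m)" using nm(3) k by (auto simp: m_def)
  then have mk: "m \<noteq> k - 3" using k by auto
  have "m \<le> k - 2" using nm(3) by arith
  then obtain B where B: "partial_span (good_span (k - 1)) (m - 1) (blocks_below k m) B" "rest_free B"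
    using Suc.IH[OF m_def] by blast
  \<comment> \<open>\<open>size ?u = m - 1\<close> makes the two attached left subtrees have sizes
    \<open>m\<close> and \<open>m + 1\<close>. If \<open>m + 1 = k - 3\<close>, then
    \<open>?q\<close> is \<open>left2\<close>, as that block requires.\<close>
  let ?u = "chain (m - 1)" and ?q = "chain (k - 2 - m)"
  have "m + 1 = k - 3 \<Longrightarrow> k - 2 - m = 2" using nm k by auto
  then have mem: "Node (Node (Node ?u Leaf) Leaf) ?q \<in> block k (Suc m)"
    using nm k by (auto simp: Node_in_block chain_2)
  have "\<exists>B'. partial_span (good_span (k - 1)) m (blocks_below k m \<union> block k (Suc m) \<union> block k m) B' \<and>
    (\<forall>e\<in>B'. e \<in> B \<union> {(Node Leaf (Node ?u (Node Leaf ?q)), Ri (Ri Cl)), (Node (Node (Node ?u Leaf) Leaf) ?q, Op),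
       (Node (Node Leaf ?u) (Node Leaf ?q), Le Op)} \<or> lifted (fst e) (snd e))"
  proof (rule partial_span_consecutive[OF B(1)])
    show "part (block k (Suc m))" "part (block k m)" using part_block[of k] ne nm k by auto
    show "blocks_below k m \<inter> block k (Suc m) = {}" "blocks_below k m \<inter> block k m = {}"
      using nm by (intro disjoint_if_Node; auto simp: Node_in_block Node_in_blocks_below Leaf_notin_blocks_below)+
    show "block k (Suc m) \<inter> block k m = {}"
      by (rule disjoint_if_Node) (auto simp: Node_in_block Leaf_notin_block)
    show "Node Leaf v \<notin> block k (Suc m) \<union> block k m" for v
      using nm by (auto simp: Node_in_block)
  qed (use nm k mk mem in \<open>auto simp: Node_in_block Node_in_blocks_below\<close>)
  then obtain B' where B': "partial_span (good_span (k - 1)) m (blocks_below k m \<union> block k (Suc m) \<union> block k m) B'"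
    "\<And>e. e \<in> B' \<Longrightarrow> e \<in> B \<union> {(Node Leaf (Node ?u (Node Leaf ?q)), Ri (Ri Cl)), (Node (Node (Node ?u Leaf) Leaf) ?q, Op),
       (Node (Node Leaf ?u) (Node Leaf ?q), Le Op)} \<or> lifted (fst e) (snd e)" by blast
  have "rest_free B'" using B(2) unfolding rest_free_def using B'(2) by fastforce
  moreover have "blocks_below k n = blocks_below k m \<union> block k (Suc m) \<union> block k m"
    using nm blocks_below_Suc[of m k] blocks_below_Suc[of "Suc m" k] by auto
  ultimately show ?case using partial_span_mono[OF B'(1), of "n - 1"] nm by auto
qed

section \<open>The general step from \<open>k - 1\<close> to \<open>k\<close>\<close>

lemma shape_sizes:
  fixes a b k :: nat
  assumes "6 \<le> k" "a \<noteq> k - 3"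
  shows "(a = 0 \<and> b = k - 1) \<or> (a = 2 \<and> b = k - 3) \<or>
     (3 \<le> a \<and> a < k - 2 \<and> b = k - 1 - a) \<or>
     (a = 1 \<and> b = k - 2) \<or> (a = k - 1 \<and> b = 0) \<or> (a = k - 2 \<and> b = 1)
     \<longleftrightarrow> a + b + 1 = k"
proof -
  consider "a = 0" | "a = 1" | "a = 2" | "3 \<le> a" "a < k - 3" | "a = k - 2" | "a = k - 1" | "k \<le> a"
    using assms by linarith
  then show ?thesis
    using assms by cases auto
qed

text \<open>\<open>alt3_consecutive\<close> with \<open>q = Leaf\<close>: for
  \<open>size u = k - 3\<close> it attaches the left subtrees of sizes \<open>k - 1\<close> and
  \<open>k - 2\<close>.\<close>

definition last_edges :: "tree \<Rightarrow> (tree \<times> addr) set" where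
  "last_edges u = {(Node Leaf (Node u one), Ri (Ri Cl)), (Node (Node (Node u Leaf) Leaf) Leaf, Op), (Node (Node Leaf u) one, Le Op)}"

text \<open>\<open>B\<close> is fixed before \<open>R\<close>, \<open>S\<close> and \<open>u\<close>
  are chosen. The last two conclusions separate it from the lifts, so that \<open>R\<close> and
  \<open>S\<close> can be read off from the union.\<close>

lemma good_span_step:
  assumes ne: "\<And>i. i < k \<Longrightarrow> i \<noteq> 2 \<Longrightarrow> good_span i \<noteq> {}" and k: "6 \<le> k"
  obtains B where
    "\<And>R S u. R \<in> good_span (k - 1) \<Longrightarrow> S \<in> good_span (k - 1) \<Longrightarrow> size u = k - 3 \<Longrightarrow>
       lift_row Leaf ` R \<union> lift_col Leaf ` S \<union> B \<union> last_edges u \<in> good_span k"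
    "\<And>t a. (Node t Leaf, a) \<notin> B"
    "\<And>t a. (Node Leaf t, Ri a) \<in> B \<Longrightarrow> forbidden t a"
proof -
  define s :: nat where "s = (if odd k then 3 else 4)"
  have "s \<le> k - 2" "even (k - 2 - s)" using k by (auto simp: s_def)
  then have "k - 2 = s + 2 * ((k - 2 - s) div 2)" by auto
  then obtain B0 where B0: "partial_span (good_span (k - 1)) (k - 2 - 1) (blocks_below k (k - 2)) B0" "rest_free B0"
    using partial_span_blocks[OF ne k, of "k - 2" "(k - 2 - s) div 2"] unfolding s_def by blast
  let ?G1 = "Node one ` trees (k - 2)" and ?Gb = "(\<lambda>u. Node u right2) ` trees (k - 3)"
  let ?W = "blocks_below k (k - 2) \<union> ?G1 \<union> ?Gb"
  \<comment> \<open>With \<open>q = right2\<close>, this size makes \<open>alt3_rest\<close> meet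
    the missing column of \<open>right2\<close>, whose left subtrees have size
    \<open>k - 3\<close>.\<close>
  let ?u = "chain (k - 6)"
  \<comment> \<open>For \<open>k = 6\<close> the left subtree \<open>Node one ?u\<close> is
    \<open>left2\<close>; for larger \<open>k\<close> it has size \<open>k - 4\<close>, and the tree
    lies in an ordinary block.\<close>
  have "k = 6 \<or> k \<ge> 7" using k by auto
  then have C_in: "Node (Node one ?u) (Node Leaf right2) \<in> blocks_below k (k - 2)"
    by (auto simp: Node_in_blocks_below)
  have "\<exists>B. partial_span (good_span (k - 1)) (k - 2 - 1) ?W B"
  proof (rule partial_span_rest[OF B0(1)])
    have "k - 2 \<noteq> 2" "k - 2 < k" "k - 3 \<noteq> 2" "k - 3 < k" using k by arith+
    then show "part ?G1" "part ?Gb" using ne by (auto intro!: part_row part_col)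
    show "blocks_below k (k - 2) \<inter> ?G1 = {}" "blocks_below k (k - 2) \<inter> ?Gb = {}"
      using k by (intro disjoint_if_Node; auto simp: Node_in_blocks_below Leaf_notin_blocks_below)+
    show "?G1 \<inter> ?Gb = {}"
      using k by (intro disjoint_if_Node) (auto simp: trees_def)
    show "Node Leaf v \<notin> ?G1 \<union> ?Gb" for v using k by auto
    show "Node (Node one ?u) (Node Leaf right2) \<in> blocks_below k (k - 2)" by (rule C_in)
  qed (use k B0(2) in \<open>auto simp: rest_free_def\<close>)
  then obtain B where B: "partial_span (good_span (k - 1)) (k - 3) ?W B" by auto
  have "k - 2 \<noteq> 2" "k - 2 < k" using k by arith+
  then have "part (box (k - 2) 1)"
    using ne good_span_1 by (intro part_box) auto
  then obtain X where X: "span (box (k - 2) 1) X" "\<And>e. e \<in> X \<Longrightarrow> lifted (fst e) (snd e)"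
    unfolding part_def by fastforce
  let ?last = "(\<lambda>u. Node u Leaf) ` trees (k - 1)"
  have fB: "fst e \<in> ?W" if "e \<in> B" for e using B that by (auto simp: partial_span_def)
  have fX: "fst e \<in> box (k - 2) 1" if "e \<in> X" for e using X(1) that span_fst by blast
  have trees_eq: "?W \<union> ?last \<union> box (k - 2) 1 = trees k"
  proof (rule set_eqI)
    fix t
    show "t \<in> ?W \<union> ?last \<union> box (k - 2) 1 \<longleftrightarrow> t \<in> trees k"
    proof (cases t)
      case Leaf
      then show ?thesis using k by (auto simp: Leaf_notin_blocks_below trees_def)
    next
      case (Node u v)
      have u: "u = Leaf \<longleftrightarrow> size u = 0" "u = one \<longleftrightarrow> size u = 1" "u = left2 \<or> u = right2 \<longleftrightarrow> size u = 2"
        by (simp_all add: size_0_iff size_1_iff size_2_iff)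
      have v: "v = Leaf \<longleftrightarrow> size v = 0" "v = left2 \<or> v = right2 \<longleftrightarrow> size v = 2"
        by (simp_all add: size_0_iff size_2_iff)
      have "t \<in> ?W \<union> ?last \<union> box (k - 2) 1 \<longleftrightarrow>
          (u = Leaf \<and> size v = k - 1) \<or> ((u = left2 \<or> u = right2) \<and> size v = k - 3) \<or>
          (3 \<le> size u \<and> size u < k - 2 \<and> (if size u = k - 3 then v = left2 else size v = k - 1 - size u)) \<or>
          (u = one \<and> size v = k - 2) \<or> (size u = k - 3 \<and> v = right2) \<or>
          (size u = k - 1 \<and> v = Leaf) \<or> (size u = k - 2 \<and> size v = 1)"
        unfolding Node Un_iff Node_in_blocks_below Node_in_row Node_in_col Node_in_box by blast
      also have "\<dots> \<longleftrightarrow> size u + size v + 1 = k"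
      proof (cases "size u = k - 3")
        case True
        then have "size u \<noteq> 0" "size u \<noteq> 1" "size u \<noteq> 2" "size u \<noteq> k - 1" "size u \<noteq> k - 2"
          "3 \<le> size u" "size u < k - 2" using k by arith+
        then have iff: "?thesis \<longleftrightarrow> ((v = left2 \<or> v = right2) \<longleftrightarrow> size u + size v + 1 = k)"
          unfolding u if_P[OF True] using True by auto
        show ?thesis by (rule iffD2[OF iff], unfold v) (use True k in arith)
      next
        case False
        then have iff: "?thesis \<longleftrightarrow> ((size u = 0 \<and> size v = k - 1) \<or> (size u = 2 \<and> size v = k - 3) \<or>
          (3 \<le> size u \<and> size u < k - 2 \<and> size v = k - 1 - size u) \<or>
          (size u = 1 \<and> size v = k - 2) \<or> (size u = k - 1 \<and> size v = 0) \<or> (size u = k - 2 \<and> size v = 1)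
          \<longleftrightarrow> size u + size v + 1 = k)"
          unfolding u v by simp
        show ?thesis by (rule iffD2[OF iff], rule shape_sizes[OF k False])
      qed
      also have "\<dots> \<longleftrightarrow> t \<in> trees k" by (simp add: Node trees_def)
      finally show ?thesis .
    qed
  qed
  show thesis
  proof (rule that[of "B \<union> X"])
    fix R S and u :: tree
    assume R: "R \<in> good_span (k - 1)" and S: "S \<in> good_span (k - 1)" and u: "size u = k - 3"
    have u2: "u \<noteq> right2" using u k by auto
    let ?x = "(Node Leaf (Node u one), Ri (Ri Cl))" and ?y = "(Node (Node (Node u Leaf) Leaf) Leaf, Op)"
      and ?z = "(Node (Node Leaf u) one, Le Op)"
    have s1: "span ?W (lift_row Leaf ` R \<union> B)" using B R by (auto simp: partial_span_def)
    have s2: "span ?last (lift_col Leaf ` S)" using S by (auto simp: good_span_def span_lift_col)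
    have d: "?W \<inter> ?last = {}" "?W \<inter> box (k - 2) 1 = {}" "?last \<inter> box (k - 2) 1 = {}"
      using k by (intro disjoint_if_Node; auto simp: Node_in_blocks_below Leaf_notin_blocks_below)+
    have m: "fst ?x \<in> ?W" "fst ?y \<in> ?last" "fst ?z \<in> box (k - 2) 1"
      using u k by (auto simp: Node_in_blocks_below)
    \<comment> \<open>Not a lift from \<open>R\<close>, since \<open>Ri Cl\<close> is forbidden for
      \<open>u\<close> other than \<open>right2\<close>; not in \<open>B\<close>, whose edges of
      this form have \<open>size u < k - 3\<close>.\<close>
    have x: "?x \<notin> lift_row Leaf ` R \<union> B"
      using not_in_lift_row[OF R, of ?x] B u u2 by (auto simp: partial_span_def)
    have y: "?y \<notin> lift_col Leaf ` S" by (auto simp: lift_col_def)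
    have z: "?z \<notin> X" using X(2)[of ?z] by auto
    have "span (?W \<union> ?last \<union> box (k - 2) 1) ((lift_row Leaf ` R \<union> B) \<union> lift_col Leaf ` S \<union> X \<union> {?x, ?y, ?z})"
      by (rule span_join3[OF s1 s2 X(1) d m x y z alt3_rotate[OF alt3_rotate[OF alt3_consecutive]]])
    moreover have "(lift_row Leaf ` R \<union> B) \<union> lift_col Leaf ` S \<union> X \<union> {?x, ?y, ?z} =
      lift_row Leaf ` R \<union> lift_col Leaf ` S \<union> (B \<union> X) \<union> last_edges u"
      unfolding last_edges_def by blast
    ultimately have "span (trees k) (lift_row Leaf ` R \<union> lift_col Leaf ` S \<union> (B \<union> X) \<union> last_edges u)"
      by (simp only: trees_eq)
    moreover have "\<not> forbidden t a"
      if "(t, a) \<in> lift_row Leaf ` R \<union> lift_col Leaf ` S \<union> (B \<union> X) \<union> last_edges u" for t a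
    proof -
      from that consider "(t, a) \<in> lift_row Leaf ` R" | "(t, a) \<in> lift_col Leaf ` S" | "(t, a) \<in> B"
        | "(t, a) \<in> X" | "(t, a) \<in> last_edges u" by blast
      then show ?thesis
      proof cases
        case 1
        with R show ?thesis by (auto simp: good_span_def lift_row_def)
      next
        case 2
        with S show ?thesis by (auto simp: good_span_def lift_col_def)
      next
        case 3
        with B show ?thesis by (auto simp: partial_span_def)
      next
        case 4
        with X(2)[of "(t, a)"] show ?thesis by (auto dest: lifted_not_forbidden)
      next
        case 5
        then show ?thesis by (auto simp: last_edges_def)
      qed
    qed
    ultimately show "lift_row Leaf ` R \<union> lift_col Leaf ` S \<union> (B \<union> X) \<union> last_edges u \<in> good_span k"
      unfolding good_span_def by blast
  next
    fix t a
    show "(Node t Leaf, a) \<notin> B \<union> X"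
      using fB[of "(Node t Leaf, a)"] fX[of "(Node t Leaf, a)"] k by (auto simp: Node_in_blocks_below split: if_splits)
  next
    fix t a assume "(Node Leaf t, Ri a) \<in> B \<union> X"
    then show "forbidden t a"
      using B fX[of "(Node Leaf t, Ri a)"] k by (auto simp: partial_span_def)
  qed
qed

section \<open>Existence and number of hypertrees\<close>

lemma good_span_nonempty: "k \<noteq> 2 \<Longrightarrow> good_span k \<noteq> {}"
proof (induction k rule: less_induct)
  case (less k)
  consider "k = 0" | "k = 1" | "k = 3" | "k = 4" | "k = 5" | "6 \<le> k" using less.prems by linarith
  then show ?case
  proof cases
    case 6
    obtain B where "\<And>R S u. R \<in> good_span (k - 1) \<Longrightarrow> S \<in> good_span (k - 1) \<Longrightarrow> size u = k - 3 \<Longrightarrow>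
       lift_row Leaf ` R \<union> lift_col Leaf ` S \<union> B \<union> last_edges u \<in> good_span k"
      using good_span_step[OF less.IH 6] by metis
    moreover have "k - 1 \<noteq> 2" "k - 1 < k" using 6 by arith+
    then obtain R where "R \<in> good_span (k - 1)" using less.IH by blast
    ultimately show ?thesis by (metis empty_iff size_chain)
  qed (use good_span_0 good_span_1 good_span_3 good_span_4 good_span_5 in auto)
qed

lemma good_span_family:
  assumes "6 \<le> k"
  shows "\<exists>F \<subseteq> good_span k. finite F \<and> card F = 2 ^ 2 ^ (k - 6)"
  using assms
proof (induction k rule: nat_induct_at_least)
  case base
  obtain B where B: "\<And>R S u. R \<in> good_span (6 - 1) \<Longrightarrow> S \<in> good_span (6 - 1) \<Longrightarrow> size u = 6 - 3 \<Longrightarrow>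
       lift_row Leaf ` R \<union> lift_col Leaf ` S \<union> B \<union> last_edges u \<in> good_span 6"
    "\<And>t a. (Node t Leaf, a) \<notin> B"
    using good_span_step[OF good_span_nonempty, of 6] by (metis order_refl)
  obtain R where R: "R \<in> good_span (6 - 1)" using good_span_nonempty[of 5] by auto
  let ?G = "\<lambda>u. lift_row Leaf ` R \<union> lift_col Leaf ` R \<union> B \<union> last_edges u"
  \<comment> \<open>Two trees of size \<open>6 - 3\<close>; the opening edge in
    \<open>last_edges\<close> tells the resulting hypertrees apart.\<close>
  let ?u1 = "Node left2 Leaf" and ?u2 = "Node right2 Leaf"
  have "(Node (Node (Node ?u1 Leaf) Leaf) Leaf, Op) \<in> ?G ?u1" by (simp add: last_edges_def)
  moreover have "(Node (Node (Node ?u1 Leaf) Leaf) Leaf, Op) \<notin> ?G ?u2"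
    using B(2) by (auto simp: last_edges_def lift_row_def lift_col_def)
  ultimately have "?G ?u1 \<noteq> ?G ?u2" by metis
  moreover have "?G ?u1 \<in> good_span 6" "?G ?u2 \<in> good_span 6" using B(1) R by simp_all
  ultimately show ?case by (intro exI[of _ "{?G ?u1, ?G ?u2}"]) simp
next
  case (Suc k)
  then obtain F where F: "F \<subseteq> good_span k" "finite F" "card F = 2 ^ 2 ^ (k - 6)" by blast
  obtain B where B: "\<And>R S u. R \<in> good_span (Suc k - 1) \<Longrightarrow> S \<in> good_span (Suc k - 1) \<Longrightarrow> size u = Suc k - 3 \<Longrightarrow>
       lift_row Leaf ` R \<union> lift_col Leaf ` S \<union> B \<union> last_edges u \<in> good_span (Suc k)"
    "\<And>t a. (Node t Leaf, a) \<notin> B"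
    "\<And>t a. (Node Leaf t, Ri a) \<in> B \<Longrightarrow> forbidden t a"
    using good_span_step[OF good_span_nonempty, of "Suc k"] Suc(1) by (metis le_SucI)
  let ?u = "chain (Suc k - 3)"
  let ?G = "\<lambda>R S. lift_row Leaf ` R \<union> lift_col Leaf ` S \<union> B \<union> last_edges ?u"
  \<comment> \<open>\<open>R\<close> removes no forbidden edge, while \<open>B\<close> and
    \<open>last_edges\<close> contain only lifts of forbidden ones to this row.\<close>
  have row: "x \<in> R \<longleftrightarrow> lift_row Leaf x \<in> ?G R S \<and> \<not> forbidden (fst x) (snd x)" if "R \<in> F" for R S x
    using that F(1) B(3)[of "fst x" "snd x"]
    by (cases x) (auto simp: lift_row_def lift_col_def last_edges_def good_span_def)
  \<comment> \<open>On trees \<open>Node t Leaf\<close>, \<open>B\<close> removes nothing and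
    \<open>last_edges\<close> only a root edge \<open>Op\<close>, which is no lift.\<close>
  have col: "x \<in> S \<longleftrightarrow> lift_col Leaf x \<in> ?G R S" for R S x
    using B(2)[of "fst x" "Le (snd x)"]
    by (cases x) (auto simp: lift_row_def lift_col_def last_edges_def)
  have "inj_on (\<lambda>(R, S). ?G R S) (F \<times> F)"
  proof (rule inj_onI, clarify)
    fix R S R' S' assume "R \<in> F" "R' \<in> F" and eq: "?G R S = ?G R' S'"
    have "x \<in> R \<longleftrightarrow> x \<in> R'" for x
      using row[OF \<open>R \<in> F\<close>, of x S] row[OF \<open>R' \<in> F\<close>, of x S'] eq by metis
    moreover have "x \<in> S \<longleftrightarrow> x \<in> S'" for x
      using col[of x S R] col[of x S' R'] eq by metis
    ultimately show "R = R' \<and> S = S'" by blast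
  qed
  then have "card ((\<lambda>(R, S). ?G R S) ` (F \<times> F)) = card F * card F"
    by (simp add: card_image card_cartesian_product)
  also have "\<dots> = 2 ^ 2 ^ Suc (k - 6)"
    unfolding F(3) by (simp add: mult_2 flip: power_add)
  also have "Suc (k - 6) = Suc k - 6" using Suc(1) by simp
  finally have "card ((\<lambda>(R, S). ?G R S) ` (F \<times> F)) = 2 ^ 2 ^ (Suc k - 6)" .
  moreover have "(\<lambda>(R, S). ?G R S) ` (F \<times> F) \<subseteq> good_span (Suc k)"
  proof -
    have "?G R S \<in> good_span (Suc k)" if "R \<in> F" "S \<in> F" for R S
      using that F(1) by (intro B(1)) auto
    then show ?thesis by auto
  qed
  ultimately show ?case using F(2) by (metis finite_SigmaI finite_imageI)
qed

theorem theorem3: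
  fixes k :: nat
  assumes "k \<ge> 6"
  shows "card {C. hamilton_cycle (odd_graph_verts k) (odd_graph_edges k) C} \<ge> 2 ^ (2 ^ (k - 6))"
proof -
  obtain F where F: "F \<subseteq> good_span k" "card F = 2 ^ 2 ^ (k - 6)"
    using good_span_family[OF assms] by blast
  then have "F \<subseteq> spanning k" by (auto simp: good_span_def spanning_def)
  from card_spanning_le[OF _ this] assms F(2) show ?thesis by simp
qed

end
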